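(* Let $(x_t)_{t\in[0,T]}$ be a PDP with characteristics $(\Phi,\lambda,Q)$ constructed by thinning, let $n\ge1$ be an integer, $t\in[0,T]$, and let $g:E\to\mathbb R$ be bounded and measurable. Then $$\mathbb E\left[g(x_t)\mathbf 1_{\{N_t=n\}}\right]=\sum_{1\le p_1<p_2<\dots<p_n\le m}\ \sum_{\theta\in\Theta}\mathbb E\left[Q\big(x^-_{T^*_{p_n}},\theta\big)\,g\big(\theta,\Phi_\theta(t-T^*_{p_n},\nu_n)\big)\mathbf 1_{\{\tau_i=p_i,\,1\le i\le n,\ N^*_t=m\}}\prod_{q=p_n+1}^{m}\left(1-\frac{\lambda(\theta,\Phi_\theta(T^*_q-T^*_{p_n},\nu_n))}{\lambda^*}\right)\right],$$ where the first sum runs over all integers $p_1,\dots,p_n,m$ with $1\le p_1<\dots<p_n\le m$, the empty product equals $1$, and on the event $\{\tau_i=p_i,1\le i\le n\}$ one has $x^-_{T^*_{p_n}}=(\theta_{n-1},\nu_n)$ (the left limit at the $n$-th jump time).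
   Context: Let $\Theta=\{k_1,\dots,k_{|\Theta|}\}$ be a finite or countable set and $E=\Theta\times\mathbb R$; elements of $E$ are written $x=(\theta,\nu)$. A piecewise deterministic process (PDP) is specified by characteristics $(\Phi,\lambda,Q)$: (Borel measurable) functions $\Phi_\theta:\mathbb R_+\times\mathbb R\to\mathbb R$, $\theta\in\Theta$; a measurable function $\lambda:E\to(0,\infty)$; a transition kernel $Q$ on $E$ of the form $Q((\theta,\nu),A\times B)=Q((\theta,\nu),A)\,\delta_\nu(B)$ for $A\subseteq\Theta$, $B\in\mathcal B(\mathbb R)$ (only the $\theta$-component jumps). We write $Q(x,\theta')=Q(x,\{\theta'\})$. Standing assumption: there is a constant $\lambda^*<\infty$ with $\lambda(x)\le\lambda^*$ for all $x\in E$. Data: on a probability space, a homogeneous Poisson process $(N^*_t)_{t\ge0}$ with intensity $\lambda^*$ and jump times $(T^*_k)_{k\ge1}$, $T^*_0=0$; two i.i.d. sequences $(U_k)_{k\ge1}$, $(V_k)_{k\ge1}$ of uniform variables on $[0,1]$, independent of each other and of $(T^*_k)$. Construction by thinning: let $a_0=0$, $a_j(x)=\sum_{i=1}^jQ(x,\{k_i\})$ and $H(x,u)=\sum_i k_i\mathbf 1_{a_{i-1}(x)<u\le a_i(x)}$. Start from a fixed $(\theta_0,\nu_0)\in E$, $T_0=0$, $\tau_0=0$. For $n\ge1$, $$\tau_n=\inf\{k>\tau_{n-1}:U_k\lambda^*\le\lambda(\theta_{n-1},\Phi_{\theta_{n-1}}(T^*_k-T^*_{\tau_{n-1}},\nu_{n-1}))\},\qquad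 T_n=T^*_{\tau_n},$$ $$\nu_n=\Phi_{\theta_{n-1}}(T_n-T_{n-1},\nu_{n-1}),\qquad \theta_n=H((\theta_{n-1},\nu_n),V_n)$$ (with $T_n=\infty$ if the set is empty). The PDP is $x_t=(\theta_n,\Phi_{\theta_n}(t-T_n,\nu_n))$ for $t\in[T_n,T_{n+1})$, with $x_0=(\theta_0,\nu_0)$, and $N_t=\sum_{n\ge1}\mathbf 1_{T_n\le t}$; one sets $x^-_{T_n}=(\theta_{n-1},\nu_n)$. *)

theory Defs
  imports "HOL-Probability.Probability"
begin

text \<open>
  The finite or countable mode set \<open>\<Theta>\<close> is the whole type \<open>'k\<close> with its discrete
  \<open>\<sigma>\<close>-algebra, enumerated by \<open>mode\<close> on \<open>{1..|\<Theta>|}\<close>, respectively on \<open>{1..}\<close>.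
\<close>

abbreviation state_space :: "('k \<times> real) measure" where
  "state_space \<equiv> count_space UNIV \<Otimes>\<^sub>M borel"

definition mode_indices :: "'k itself \<Rightarrow> nat set" where
  "mode_indices _ = {i. 1 \<le> i \<and> (finite (UNIV :: 'k set) \<longrightarrow> i \<le> card (UNIV :: 'k set))}"

text \<open>
  A record collects the probability space, the enumeration of \<open>\<Theta>\<close>, the characteristics
  \<open>(\<Phi>, \<lambda>, Q)\<close>, the bound \<open>\<lambda>\<^sup>*\<close>, the driving processes and the initial state.
\<close>

record ('k, 'w) thinning_data =
  Pr :: "'w measure"
  mode :: "nat \<Rightarrow> 'k"
  \<Phi> :: "'k \<Rightarrow> real \<Rightarrow> real \<Rightarrow> real"
  rate :: "'k \<times> real \<Rightarrow> real"
  kernel :: "'k \<times> real \<Rightarrow> ('k \<times> real) measure"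
  rate_bound :: real
  Nstar :: "real \<Rightarrow> 'w \<Rightarrow> nat"
  Tstar :: "nat \<Rightarrow> 'w \<Rightarrow> real"
  Useq :: "nat \<Rightarrow> 'w \<Rightarrow> real"
  Vseq :: "nat \<Rightarrow> 'w \<Rightarrow> real"
  \<theta>\<^sub>0 :: 'k
  \<nu>\<^sub>0 :: real

text \<open>
  A homogeneous Poisson process \<open>N\<close> of intensity \<open>r\<close>, as a counting process with jump times
  \<open>0 = T 0 < T 1 < T 2 < \<dots>\<close> that do not accumulate.  The subtraction on \<open>nat\<close> is exact because
  the paths of \<open>N\<close> are nondecreasing.
\<close>

definition homogeneous_poisson_process ::
    "'w measure \<Rightarrow> real \<Rightarrow> (real \<Rightarrow> 'w \<Rightarrow> nat) \<Rightarrow> (nat \<Rightarrow> 'w \<Rightarrow> real) \<Rightarrow> bool" where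
  "homogeneous_poisson_process M r N T \<longleftrightarrow>
     (\<forall>j. T j \<in> borel_measurable M) \<and>
     (\<forall>t\<ge>0. N t \<in> M \<rightarrow>\<^sub>M count_space UNIV) \<and>
     (\<forall>\<omega>\<in>space M. T 0 \<omega> = 0 \<and> strict_mono (\<lambda>j. T j \<omega>) \<and>
        (\<forall>t\<ge>0. finite {j. 1 \<le> j \<and> T j \<omega> \<le> t} \<and> N t \<omega> = card {j. 1 \<le> j \<and> T j \<omega> \<le> t})) \<and>
     (\<forall>s t. 0 \<le> s \<and> s < t \<longrightarrow>
        distr M (count_space UNIV) (\<lambda>\<omega>. N t \<omega> - N s \<omega>) = measure_pmf (poisson_pmf (r * (t - s)))) \<and>
     (\<forall>s n. 0 \<le> s 0 \<and> mono s \<longrightarrow>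
        prob_space.indep_vars M (\<lambda>_. count_space UNIV)
          (\<lambda>i \<omega>. N (s (Suc i)) \<omega> - N (s i) \<omega>) {..<n::nat})"

definition iid_uniform :: "'w measure \<Rightarrow> (nat \<Rightarrow> 'w \<Rightarrow> real) \<Rightarrow> bool" where
  "iid_uniform M X \<longleftrightarrow>
     prob_space.indep_vars M (\<lambda>_. borel) X {1..} \<and>
     (\<forall>j\<ge>1. distr M borel (X j) = uniform_measure lborel {0..1})"


context
  fixes D :: "('k, 'w) thinning_data"
begin

text \<open>\<open>Q_mode x \<theta>\<close> is \<open>Q(x, {\<theta>})\<close>, the kernel on the mode component.\<close>

definition Q_mode :: "'k \<times> real \<Rightarrow> 'k \<Rightarrow> real" where
  "Q_mode x \<theta> = measure (kernel D x) ({\<theta>} \<times> UNIV)"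

definition a_sum :: "nat \<Rightarrow> 'k \<times> real \<Rightarrow> real" where
  "a_sum j x = (\<Sum>i \<in> {1..j} \<inter> mode_indices TYPE('k). Q_mode x (mode D i))"

text \<open>
  \<open>H_mode x u\<close> is the formal sum \<open>\<Sum>\<^sub>i k\<^sub>i 1{a\<^sub>i\<^sub>-\<^sub>1(x) < u \<le> a\<^sub>i(x)}\<close>, at most one term of which is
  present.  When there is none, which for uniform \<open>u\<close> has probability zero, the value
  is set to \<open>k\<^sub>1\<close>.
\<close>

definition H_mode :: "'k \<times> real \<Rightarrow> real \<Rightarrow> 'k" where
  "H_mode x u =
     (if \<exists>i \<in> mode_indices TYPE('k). a_sum (i - 1) x < u \<and> u \<le> a_sum i x
      then mode D (THE i. i \<in> mode_indices TYPE('k) \<and> a_sum (i - 1) x < u \<and> u \<le> a_sum i x)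
      else mode D 1)"

text \<open>
  The index \<open>\<tau> n\<close> is \<open>\<infinity>\<close> (the infimum of the empty set) from the first failed search onwards;
  \<open>\<nu>\<close> is then frozen by convention, a value that never enters the process.
\<close>

fun \<tau> :: "nat \<Rightarrow> 'w \<Rightarrow> enat" and \<nu> :: "nat \<Rightarrow> 'w \<Rightarrow> real" and \<theta> :: "nat \<Rightarrow> 'w \<Rightarrow> 'k" where
  "\<tau> 0 \<omega> = 0"
| "\<tau> (Suc n) \<omega> = Inf {enat j | j. \<tau> n \<omega> < enat j \<and>
     Useq D j \<omega> * rate_bound D
       \<le> rate D (\<theta> n \<omega>, \<Phi> D (\<theta> n \<omega>) (Tstar D j \<omega> - Tstar D (the_enat (\<tau> n \<omega>)) \<omega>) (\<nu> n \<omega>))}"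
| "\<nu> 0 \<omega> = \<nu>\<^sub>0 D"
| "\<nu> (Suc n) \<omega> = (case \<tau> (Suc n) \<omega> of
       enat j \<Rightarrow> \<Phi> D (\<theta> n \<omega>) (Tstar D j \<omega> - Tstar D (the_enat (\<tau> n \<omega>)) \<omega>) (\<nu> n \<omega>)
     | \<infinity> \<Rightarrow> \<nu> n \<omega>)"
| "\<theta> 0 \<omega> = \<theta>\<^sub>0 D"
| "\<theta> (Suc n) \<omega> = H_mode (\<theta> n \<omega>, \<nu> (Suc n) \<omega>) (Vseq D (Suc n) \<omega>)"

definition jump_time :: "nat \<Rightarrow> 'w \<Rightarrow> ereal" where
  "jump_time n \<omega> = (case \<tau> n \<omega> of enat j \<Rightarrow> ereal (Tstar D j \<omega>) | \<infinity> \<Rightarrow> \<infinity>)"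

definition jump_count :: "real \<Rightarrow> 'w \<Rightarrow> nat" where
  "jump_count t \<omega> = card {n. 1 \<le> n \<and> jump_time n \<omega> \<le> ereal t}"

text \<open>
  No flow property \<open>\<Phi> \<theta> 0 \<nu> = \<nu>\<close> is assumed, so the initial value is imposed separately.
\<close>

definition pdp :: "real \<Rightarrow> 'w \<Rightarrow> 'k \<times> real" where
  "pdp t \<omega> =
     (if t = 0 then (\<theta>\<^sub>0 D, \<nu>\<^sub>0 D)
      else let n = (THE n. jump_time n \<omega> \<le> ereal t \<and> ereal t < jump_time (Suc n) \<omega>)
           in (\<theta> n \<omega>, \<Phi> D (\<theta> n \<omega>) (t - real_of_ereal (jump_time n \<omega>)) (\<nu> n \<omega>)))"

text \<open>\<open>pdp_minus s\<close> is \<open>x\<^sup>-\<^sub>s\<close>, meaningful when \<open>s\<close> is one of the jump times \<open>jump_time n\<close>, \<open>n \<ge> 1\<close>.\<close>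

definition pdp_minus :: "real \<Rightarrow> 'w \<Rightarrow> 'k \<times> real" where
  "pdp_minus s \<omega> = (let n = (THE n. 1 \<le> n \<and> jump_time n \<omega> = ereal s) in (\<theta> (n - 1) \<omega>, \<nu> n \<omega>))"

end


locale pdp_thinning = prob_space "Pr D" for D :: "('k, 'w) thinning_data" +
  assumes mode_enum: "bij_betw (mode D) (mode_indices TYPE('k)) UNIV"
    and flow_measurable: "\<And>\<theta>. (\<lambda>(s, \<nu>). \<Phi> D \<theta> s \<nu>) \<in> borel_measurable (restrict_space borel ({0..} \<times> UNIV))"
    and rate_measurable: "rate D \<in> borel_measurable state_space"
    and rate_pos: "\<And>x. 0 < rate D x"
    and rate_le: "\<And>x. rate D x \<le> rate_bound D"
    and kernel: "kernel D \<in> state_space \<rightarrow>\<^sub>M prob_algebra state_space"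
    and kernel_mode_only: "\<And>\<theta> \<nu> A B. B \<in> sets borel \<Longrightarrow>
      emeasure (kernel D (\<theta>, \<nu>)) (A \<times> B) = emeasure (kernel D (\<theta>, \<nu>)) (A \<times> UNIV) * indicator B \<nu>"
    and poisson: "homogeneous_poisson_process (Pr D) (rate_bound D) (Nstar D) (Tstar D)"
    and U_uniform: "iid_uniform (Pr D) (Useq D)"
    and V_uniform: "iid_uniform (Pr D) (Vseq D)"
    \<comment> \<open>the three sequences are mutually independent\<close>
    and independent: "indep_vars (\<lambda>_. PiM {1..} (\<lambda>_. borel))
      (\<lambda>i \<omega>. \<lambda>j\<in>{1..}. ([Tstar D, Useq D, Vseq D] ! i) j \<omega>) {..<3::nat}"

end

theory Submission
  imports Defs
begin

text \<open>
  Fix the candidate indices \<open>p\<^sub>1 < \<dots> < p\<^sub>n\<close>, the number \<open>m\<close> of Poisson points up to \<open>t\<close> and the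
  mode \<open>k\<close> chosen at the \<open>n\<close>-th jump.  With \<open>p\<close> prescribed, the post-jump states become explicit
  functions of the driving sequences: \<open>\<nu>\<^sub>n\<close> and the event \<open>\<tau>\<^sub>i = p\<^sub>i\<close> (\<open>i \<le> n\<close>) involve only the Poisson
  times, \<open>U\<^sub>1, \<dots>, U\<^bsub>p n\<^esub>\<close> and \<open>V\<^sub>1, \<dots>, V\<^bsub>n-1\<^esub>\<close>.  On \<open>\<theta>\<^sub>n = k\<close>, the event \<open>N\<^sub>t = n\<close> says that every candidate
  \<open>q\<close> with \<open>p\<^sub>n < q \<le> m\<close> is rejected, where the rejection threshold for \<open>U\<^sub>q\<close> may be computed with \<open>k\<close> in place of
  \<open>\<theta>\<^sub>n\<close> and hence does not involve \<open>V\<^sub>n\<close>.  Integrating out these \<open>U\<^sub>q\<close> yields the product of the \<open>1 - \<lambda> / \<lambda>\<^sup>*\<close>,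
  and integrating out \<open>V\<^sub>n\<close> turns the indicator of \<open>\<theta>\<^sub>n = k\<close> into \<open>Q\<close>.  The events for different \<open>(p, m, k)\<close>
  are disjoint, so the integrals add up.
\<close>

section \<open>Sums of integrals, product measures and uniform variables\<close>

text \<open>Dominated convergence for unordered sums: the partial sums of absolute values stay below
  the constant \<open>C\<close>, which is integrable over a finite measure. The family is
  transported to a series over the naturals, integrated termwise there, and transported
  back.\<close>

lemma (in finite_measure) has_sum_integral:
  fixes F :: "'i \<Rightarrow> 'a \<Rightarrow> real"
  assumes J: "countable J"
    and meas: "\<And>j. j \<in> J \<Longrightarrow> F j \<in> borel_measurable M"
    and sum: "\<And>x. x \<in> space M \<Longrightarrow> ((\<lambda>j. F j x) has_sum f x) J"
    and bound: "\<And>x A. x \<in> space M \<Longrightarrow> finite A \<Longrightarrow> A \<subseteq> J \<Longrightarrow> (\<Sum>j\<in>A. \<bar>F j x\<bar>) \<le> C"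
  shows "((\<lambda>j. \<integral>x. F j x \<partial>M) has_sum (\<integral>x. f x \<partial>M)) J"
proof -
  define I where "I = to_nat_on J ` J"
  \<comment> \<open>Extension by zero off the range of the enumeration treats finite and infinite
    \<open>J\<close> alike.\<close>
  define G where "G k x = (if k \<in> I then F (from_nat_into J k) x else 0)" for k x
  have inj: "inj_on (to_nat_on J) J"
    using J by (rule inj_on_to_nat_on)
  have G_F: "G (to_nat_on J j) = F j" if "j \<in> J" for j
    using that J by (simp add: G_def I_def fun_eq_iff)
  have has_sum_G: "(h has_sum s) UNIV \<longleftrightarrow> ((\<lambda>j. h (to_nat_on J j)) has_sum s) J"
    if "\<And>k. k \<notin> I \<Longrightarrow> h k = 0" for h :: "nat \<Rightarrow> real" and s
  proof -
    have "(h has_sum s) UNIV \<longleftrightarrow> (h has_sum s) I"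
      using that by (intro has_sum_cong_neutral) auto
    also have "\<dots> \<longleftrightarrow> ((h \<circ> to_nat_on J) has_sum s) J"
      unfolding I_def by (rule has_sum_reindex[OF inj])
    finally show ?thesis
      by (simp add: comp_def)
  qed
  have G_meas[measurable]: "G k \<in> borel_measurable M" for k
  proof (cases "k \<in> I")
    case True
    then have "from_nat_into J k \<in> J"
      by (auto simp: I_def intro!: from_nat_into)
    with True show ?thesis
      using meas by (simp add: G_def[abs_def])
  qed (simp add: G_def[abs_def])
  have G_bound: "(\<Sum>k<N. \<bar>G k x\<bar>) \<le> C" if "x \<in> space M" for N x
  proof -
    define A where "A = {j \<in> J. to_nat_on J j < N}"
    have img: "to_nat_on J ` A = I \<inter> {..<N}"
      by (auto simp: A_def I_def)
    have injA: "inj_on (to_nat_on J) A"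
      by (rule inj_on_subset[OF inj]) (auto simp: A_def)
    have "finite (to_nat_on J ` A)"
      unfolding img by simp
    then have finA: "finite A"
      using injA by (rule finite_imageD)
    have "(\<Sum>k<N. \<bar>G k x\<bar>) = (\<Sum>k\<in>I \<inter> {..<N}. \<bar>G k x\<bar>)"
      by (rule sum.mono_neutral_right) (auto simp: G_def)
    also have "\<dots> = (\<Sum>j\<in>A. \<bar>G (to_nat_on J j) x\<bar>)"
      unfolding img[symmetric] by (simp add: sum.reindex[OF injA])
    also have "\<dots> = (\<Sum>j\<in>A. \<bar>F j x\<bar>)"
      by (rule sum.cong) (auto simp: A_def G_F)
    also have "\<dots> \<le> C"
      using that finA by (intro bound) (auto simp: A_def)
    finally show ?thesis .
  qed
  have G_le: "\<bar>G k x\<bar> \<le> C" if "x \<in> space M" for k x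
  proof -
    have "\<bar>G k x\<bar> \<le> (\<Sum>i<Suc k. \<bar>G i x\<bar>)"
      by (simp add: sum_nonneg)
    with G_bound[OF that, of "Suc k"] show ?thesis by linarith
  qed
  have G_int: "integrable M (G k)" for k
    by (rule integrable_const_bound[where B = C]) (auto intro!: AE_I2 G_le)
  have summable_x: "summable (\<lambda>k. \<bar>G k x\<bar>)" if "x \<in> space M" for x
    by (rule summableI_nonneg_bounded[where x = C]) (auto intro: G_bound[OF that])
  have summable_int: "summable (\<lambda>k. \<integral>x. \<bar>G k x\<bar> \<partial>M)"
  proof (rule summableI_nonneg_bounded[where x = "C * measure M (space M)"])
    fix N
    have "(\<Sum>k<N. \<integral>x. \<bar>G k x\<bar> \<partial>M) = (\<integral>x. (\<Sum>k<N. \<bar>G k x\<bar>) \<partial>M)"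
      by (rule Bochner_Integration.integral_sum[symmetric]) (auto intro: G_int)
    also have "\<dots> \<le> (\<integral>x. C \<partial>M)"
      by (intro integral_mono Bochner_Integration.integrable_sum integrable_abs G_int) (auto intro: G_bound)
    finally show "(\<Sum>k<N. \<integral>x. \<bar>G k x\<bar> \<partial>M) \<le> C * measure M (space M)"
      by (simp add: mult.commute)
  qed simp
  have "(\<lambda>k. integral\<^sup>L M (G k)) sums (\<integral>x. (\<Sum>k. G k x) \<partial>M)"
    using G_int summable_x summable_int by (intro sums_integral) auto
  also have "(\<integral>x. (\<Sum>k. G k x) \<partial>M) = (\<integral>x. f x \<partial>M)"
  proof (rule Bochner_Integration.integral_cong[OF refl])
    fix x assume x: "x \<in> space M"
    have "((\<lambda>j. G (to_nat_on J j) x) has_sum f x) J"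
      using sum[OF x] by (simp add: G_F cong: has_sum_cong)
    then have "((\<lambda>k. G k x) has_sum f x) UNIV"
      by (subst has_sum_G) (auto simp: G_def)
    then show "(\<Sum>k. G k x) = f x"
      by (metis has_sum_imp_sums sums_unique)
  qed
  finally have "(\<lambda>k. integral\<^sup>L M (G k)) sums (\<integral>x. f x \<partial>M)" .
  \<comment> \<open>Absolute summability of the integrals upgrades the convergent series to an
    unordered sum.\<close>
  moreover have "summable (\<lambda>k. norm (integral\<^sup>L M (G k)))"
    by (rule summable_comparison_test'[OF summable_int]) (auto simp: integral_abs_bound)
  ultimately have "((\<lambda>k. integral\<^sup>L M (G k)) has_sum (\<integral>x. f x \<partial>M)) UNIV"
    by (intro norm_summable_imp_has_sum)
  then have "((\<lambda>j. integral\<^sup>L M (G (to_nat_on J j))) has_sum (\<integral>x. f x \<partial>M)) J"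
    by (subst (asm) has_sum_G) (auto simp: G_def[abs_def])
  then show ?thesis
    by (simp add: G_F cong: has_sum_cong)
qed

text \<open>Fubini for the splitting of the coordinates into \<open>J\<close> and \<open>K\<close>:
  once those in \<open>J\<close> are frozen, the factors \<open>h q\<close> involve distinct
  independent coordinates, so the integral of their product factorizes. It is applied once to the
  uniforms of the late candidates and once to the single uniform that chooses the last mode.\<close>

lemma (in product_prob_space) integral_PiM_prod:
  fixes A :: "('i \<Rightarrow> 'a) \<Rightarrow> real" and h :: "'i \<Rightarrow> ('i \<Rightarrow> 'a) \<Rightarrow> 'a \<Rightarrow> real"
  assumes JK: "J \<inter> K = {}" "finite J" "finite K"
    and A_local: "\<And>u v. (\<And>j. j \<in> J \<Longrightarrow> u j = v j) \<Longrightarrow> A u = A v"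
    and h_local: "\<And>q u v y. q \<in> K \<Longrightarrow> (\<And>j. j \<in> J \<Longrightarrow> u j = v j) \<Longrightarrow> h q u y = h q v y"
    and h_int: "\<And>q u. q \<in> K \<Longrightarrow> integrable (M q) (h q u)"
    and int1: "integrable (PiM (J \<union> K) M) (\<lambda>u. A u * (\<Prod>q\<in>K. h q u (u q)))"
    and int2: "integrable (PiM (J \<union> K) M) (\<lambda>u. A u * (\<Prod>q\<in>K. \<integral>y. h q u y \<partial>M q))"
  shows "(\<integral>u. A u * (\<Prod>q\<in>K. h q u (u q)) \<partial>PiM (J \<union> K) M)
       = (\<integral>u. A u * (\<Prod>q\<in>K. \<integral>y. h q u y \<partial>M q) \<partial>PiM (J \<union> K) M)"
proof -
  have A_merge: "A (merge J K (u, v)) = A u" for u v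
    using JK by (intro A_local) simp
  have h_merge: "h q (merge J K (u, v)) = h q u" if "q \<in> K" for q u v
    using JK that by (intro ext h_local) simp_all
  interpret K: prob_space "PiM K M"
    by (intro prob_space_PiM prob_space)
  have "(\<integral>u. A u * (\<Prod>q\<in>K. h q u (u q)) \<partial>PiM (J \<union> K) M)
      = (\<integral>u. (\<integral>v. A u * (\<Prod>q\<in>K. h q u (v q)) \<partial>PiM K M) \<partial>PiM J M)"
    unfolding product_integral_fold[OF JK int1]
    using JK by (intro Bochner_Integration.integral_cong refl) (auto simp: A_merge h_merge intro!: prod.cong)
  also have "\<dots> = (\<integral>u. (\<integral>v. A u * (\<Prod>q\<in>K. \<integral>y. h q u y \<partial>M q) \<partial>PiM K M) \<partial>PiM J M)"
  proof (rule Bochner_Integration.integral_cong[OF refl])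
    fix u
    have "(\<integral>v. (\<Prod>q\<in>K. h q u (v q)) \<partial>PiM K M) = (\<Prod>q\<in>K. \<integral>y. h q u y \<partial>M q)"
      by (rule product_integral_prod) (auto intro: JK h_int)
    then show "(\<integral>v. A u * (\<Prod>q\<in>K. h q u (v q)) \<partial>PiM K M)
        = (\<integral>v. A u * (\<Prod>q\<in>K. \<integral>y. h q u y \<partial>M q) \<partial>PiM K M)"
      by (simp add: K.prob_space)
  qed
  also have "\<dots> = (\<integral>u. A u * (\<Prod>q\<in>K. \<integral>y. h q u y \<partial>M q) \<partial>PiM (J \<union> K) M)"
    unfolding product_integral_fold[OF JK int2]
    by (intro Bochner_Integration.integral_cong refl) (auto simp: A_merge h_merge intro!: prod.cong)
  finally show ?thesis .
qed

abbreviation uniform01 :: "real measure" where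
  "uniform01 \<equiv> uniform_measure lborel {0..1}"

lemma prob_space_uniform01: "prob_space uniform01"
  by (rule prob_space_uniform_measure) auto

lemma measure_uniform01_Ioc:
  assumes "0 \<le> a" "a \<le> b" "b \<le> 1"
  shows "measure uniform01 {a<..b} = b - a"
proof -
  have "{0..1} \<inter> {a<..b} = {a<..b}"
    using assms by auto
  with assms show ?thesis
    by (simp add: measure_uniform_measure)
qed

lemma measure_uniform01_Ioi:
  assumes "0 \<le> c" "c \<le> 1"
  shows "measure uniform01 {c<..} = 1 - c"
proof -
  have "{0..1} \<inter> {c<..} = {c<..1}"
    using assms by auto
  with assms show ?thesis
    by (simp add: measure_uniform_measure)
qed

text \<open>Well-ordering: a finite infimum is attained and nothing smaller satisfies
  \<open>P\<close>. This turns the definition of \<open>\<tau>\<close> into "first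
  acceptance".\<close>

lemma Inf_enat_eq_iff: "Inf {enat j | j. P j} = enat k \<longleftrightarrow> P k \<and> (\<forall>j<k. \<not> P j)"
proof
  assume *: "Inf {enat j | j. P j} = enat k"
  \<comment> \<open>The empty set has infimum \<open>\<infinity>\<close>, so a finite value forces
    nonemptiness.\<close>
  then have "{enat j | j. P j} \<noteq> {}"
    by (auto simp: Inf_enat_def simp del: Collect_empty_eq split: if_splits)
  then have "Inf {enat j | j. P j} \<in> {enat j | j. P j}"
    unfolding Inf_enat_def by (metis (mono_tags, lifting) LeastI_ex all_not_in_conv)
  moreover have "enat k \<le> enat j" if "P j" for j
    unfolding *[symmetric] using that by (intro Inf_lower) auto
  ultimately show "P k \<and> (\<forall>j<k. \<not> P j)"
    using * by (auto simp: not_le[symmetric])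
next
  assume *: "P k \<and> (\<forall>j<k. \<not> P j)"
  show "Inf {enat j | j. P j} = enat k"
  proof (rule antisym)
    show "Inf {enat j | j. P j} \<le> enat k"
      using * by (intro Inf_lower) auto
    show "enat k \<le> Inf {enat j | j. P j}"
      using * by (intro Inf_greatest) (auto simp: not_less[symmetric])
  qed
qed

text \<open>Disjoint blocks of an independent family are independent, and so are measurable images
  of them. The factorization is obtained by first separating index 1 from index 2, and then index 0
  from the block formed by both.\<close>

lemma (in prob_space) distr_three_indep:
  assumes "indep_vars M' X {..<3::nat}"
  shows "distr M (M' 0 \<Otimes>\<^sub>M (M' 1 \<Otimes>\<^sub>M M' 2)) (\<lambda>\<omega>. (X 0 \<omega>, (X 1 \<omega>, X 2 \<omega>)))
       = distr M (M' 0) (X 0) \<Otimes>\<^sub>M (distr M (M' 1) (X 1) \<Otimes>\<^sub>M distr M (M' 2) (X 2))"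
proof -
  define R where "R K \<omega> = (\<lambda>i\<in>K. X i \<omega>)" for K \<omega>
  have factor: "distr M (PiM K M') (R K) \<Otimes>\<^sub>M distr M (PiM L M') (R L)
      = distr M (PiM K M' \<Otimes>\<^sub>M PiM L M') (\<lambda>\<omega>. (R K \<omega>, R L \<omega>))"
    if "K \<inter> L = {}" "K \<subseteq> {..<3}" "L \<subseteq> {..<3}" for K L
    using indep_var_restrict[OF assms that] by (simp add: indep_var_distribution_eq R_def[abs_def])
  have X_meas[measurable]: "X i \<in> M \<rightarrow>\<^sub>M M' i" if "i < 3" for i
    using assms that by (auto simp: indep_vars_def)
  have R_meas[measurable]: "R K \<in> M \<rightarrow>\<^sub>M PiM K M'" if "K \<subseteq> {..<3}" for K
    using that unfolding R_def[abs_def] by (intro measurable_restrict X_meas) auto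
  have map_factor: "distr M S (\<lambda>\<omega>. f (R K \<omega>)) \<Otimes>\<^sub>M distr M T (\<lambda>\<omega>. g (R L \<omega>))
      = distr M (S \<Otimes>\<^sub>M T) (\<lambda>\<omega>. (f (R K \<omega>), g (R L \<omega>)))"
    if KL: "K \<inter> L = {}" "K \<subseteq> {..<3}" "L \<subseteq> {..<3}"
      and [measurable]: "f \<in> PiM K M' \<rightarrow>\<^sub>M S" "g \<in> PiM L M' \<rightarrow>\<^sub>M T"
    for K L and S :: "'c measure" and T :: "'d measure" and f g
  proof -
    note [measurable] = R_meas[OF KL(2)] R_meas[OF KL(3)]
    interpret T: prob_space "distr M T (\<lambda>\<omega>. g (R L \<omega>))"
      by (rule prob_space_distr) measurable
    have f: "distr M S (\<lambda>\<omega>. f (R K \<omega>)) = distr (distr M (PiM K M') (R K)) S f"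
      by (simp add: distr_distr comp_def)
    have g: "distr M T (\<lambda>\<omega>. g (R L \<omega>)) = distr (distr M (PiM L M') (R L)) T g"
      by (simp add: distr_distr comp_def)
    have "distr M S (\<lambda>\<omega>. f (R K \<omega>)) \<Otimes>\<^sub>M distr M T (\<lambda>\<omega>. g (R L \<omega>))
        = distr (distr M (PiM K M') (R K) \<Otimes>\<^sub>M distr M (PiM L M') (R L)) (S \<Otimes>\<^sub>M T) (\<lambda>(x, y). (f x, g y))"
      using T.sigma_finite_measure_axioms unfolding f g by (intro pair_measure_distr) auto
    also have "\<dots> = distr M (S \<Otimes>\<^sub>M T) (\<lambda>\<omega>. (f (R K \<omega>), g (R L \<omega>)))"
      by (subst factor[OF KL]) (simp add: distr_distr comp_def)
    finally show ?thesis .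
  qed
  have "distr M (M' 1) (X 1) \<Otimes>\<^sub>M distr M (M' 2) (X 2) = distr M (M' 1 \<Otimes>\<^sub>M M' 2) (\<lambda>\<omega>. (X 1 \<omega>, X 2 \<omega>))"
    using map_factor[of "{1}" "{2}" "\<lambda>x. x 1" "M' 1" "\<lambda>x. x 2" "M' 2"]
    by (simp add: R_def)
  moreover have "distr M (M' 0) (X 0) \<Otimes>\<^sub>M distr M (M' 1 \<Otimes>\<^sub>M M' 2) (\<lambda>\<omega>. (X 1 \<omega>, X 2 \<omega>))
      = distr M (M' 0 \<Otimes>\<^sub>M (M' 1 \<Otimes>\<^sub>M M' 2)) (\<lambda>\<omega>. (X 0 \<omega>, (X 1 \<omega>, X 2 \<omega>)))"
    using map_factor[of "{0}" "{1, 2}" "\<lambda>x. x 0" "M' 0" "\<lambda>x. (x 1, x 2)" "M' 1 \<Otimes>\<^sub>M M' 2"]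
    by (simp add: R_def)
  ultimately show ?thesis by simp
qed

text \<open>Outside \<open>I\<close> the elements of the product are extensional, so the coordinate
  is the constant \<open>undefined\<close>. Later measurability arguments can therefore speak of all
  coordinates at once.\<close>

lemma measurable_PiM_component:
  "(\<lambda>x. x i) \<in> PiM I (\<lambda>_. M) \<rightarrow>\<^sub>M M" if "i \<in> I \<or> undefined \<in> space M"
proof (cases "i \<in> I")
  case False
  then have "(\<lambda>x. x i) \<in> PiM I (\<lambda>_. M) \<rightarrow>\<^sub>M M \<longleftrightarrow> (\<lambda>x. undefined) \<in> PiM I (\<lambda>_. M) \<rightarrow>\<^sub>M M"
    by (intro measurable_cong) (auto simp: space_PiM)
  with False that show ?thesis by simp
qed (rule measurable_component_singleton)

section \<open>The process along prescribed jump indices\<close>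

text \<open>The flow is only assumed measurable for nonnegative times, hence the truncation.\<close>

definition flow_at :: "('k, 'w) thinning_data \<Rightarrow> 'k \<times> real \<Rightarrow> real \<Rightarrow> real" where
  "flow_at D x s = \<Phi> D (fst x) (max 0 s) (snd x)"

definition intensity :: "('k, 'w) thinning_data \<Rightarrow> 'k \<times> real \<Rightarrow> real \<Rightarrow> real" where
  "intensity D x s = rate D (fst x, flow_at D x s)"

text \<open>The mode and position after each jump, with the random indices \<open>\<tau>\<close>
  replaced by prescribed ones. This makes the state a function of \<open>T\<close> and
  \<open>V\<close> alone, so that its dependence on single coordinates can be tracked.\<close>

primrec indexed_path :: "('k, 'w) thinning_data \<Rightarrow> (nat \<Rightarrow> nat) \<Rightarrow> (nat \<Rightarrow> real) \<Rightarrow> (nat \<Rightarrow> real) \<Rightarrow> nat \<Rightarrow> 'k \<times> real" where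
  "indexed_path D p T V 0 = (\<theta>\<^sub>0 D, \<nu>\<^sub>0 D)"
| "indexed_path D p T V (Suc i) =
     (let y = flow_at D (indexed_path D p T V i) (T (p (Suc i)) - T (p i))
      in (H_mode D (fst (indexed_path D p T V i), y) (V (Suc i)), y))"

text \<open>One stage of the thinning read along \<open>p\<close>: conjoined over
  \<open>i < n\<close>, it expresses that the first \<open>n\<close> searches stop exactly at the
  prescribed indices.\<close>

definition accepted :: "('k, 'w) thinning_data \<Rightarrow> (nat \<Rightarrow> nat) \<Rightarrow> (nat \<Rightarrow> real) \<Rightarrow> (nat \<Rightarrow> real) \<Rightarrow> (nat \<Rightarrow> real) \<Rightarrow> nat \<Rightarrow> bool" where
  "accepted D p T U V i \<longleftrightarrow>
     U (p (Suc i)) * rate_bound D \<le> intensity D (indexed_path D p T V i) (T (p (Suc i)) - T (p i)) \<and>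
     (\<forall>k\<in>{p i<..<p (Suc i)}. intensity D (indexed_path D p T V i) (T k - T (p i)) < U k * rate_bound D)"

lemma indexed_path_cong:
  assumes "\<And>j. 1 \<le> j \<Longrightarrow> j \<le> i \<Longrightarrow> V j = V' j"
  shows "indexed_path D p T V i = indexed_path D p T V' i"
  using assms by (induction i) (auto simp: Let_def)

text \<open>The position at the \<open>i\<close>-th jump comes from the flow of the previous mode,
  before \<open>V i\<close> is drawn. This is what later leaves \<open>V n\<close> free to be
  averaged.\<close>

lemma snd_indexed_path_cong:
  assumes "\<And>j. 1 \<le> j \<Longrightarrow> j < i \<Longrightarrow> V j = V' j"
  shows "snd (indexed_path D p T V i) = snd (indexed_path D p T V' i)"
proof (cases i)
  case (Suc l)
  then have "indexed_path D p T V l = indexed_path D p T V' l"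
    using assms by (intro indexed_path_cong) auto
  with Suc show ?thesis by (simp add: Let_def)
qed simp

text \<open>Stage \<open>i\<close> inspects no uniform beyond \<open>p (Suc i)\<close>, which leaves
  the candidates after the last prescribed jump free. Since \<open>p\<close> increases,
  \<open>p (Suc i)\<close> is positive and \<open>U 0\<close> is never read.\<close>

lemma accepted_cong:
  assumes "p i < p (Suc i)"
    and "\<And>j. 1 \<le> j \<Longrightarrow> j \<le> i \<Longrightarrow> V j = V' j"
    and "\<And>j. 1 \<le> j \<Longrightarrow> j \<le> p (Suc i) \<Longrightarrow> U j = U' j"
  shows "accepted D p T U V i = accepted D p T U' V' i"
proof -
  have "indexed_path D p T V i = indexed_path D p T V' i"
    using assms(2) by (rule indexed_path_cong)
  with assms(1,3) show ?thesis
    by (auto simp: accepted_def)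
qed

text \<open>Both counting processes are defined as cardinalities; this fact converts them into order
  statements about the event times.\<close>

lemma downclosed_eq_atLeastAtMost_card:
  assumes "finite A" and "0 \<notin> A" and "\<And>i j. j \<in> A \<Longrightarrow> 1 \<le> i \<Longrightarrow> i \<le> j \<Longrightarrow> i \<in> A"
  shows "A = {1..card A}"
proof -
  \<comment> \<open>Inserting 0 gives the maximum a meaning for empty \<open>A\<close> as
    well.\<close>
  have "A = {1..Max (insert 0 A)}"
  proof (intro equalityI subsetI)
    fix i assume "i \<in> A"
    with assms(1,2) show "i \<in> {1..Max (insert 0 A)}"
      by (metis Max_ge One_nat_def Suc_leI atLeastAtMost_iff finite_insert insertCI neq0_conv)
  next
    fix i assume i: "i \<in> {1..Max (insert 0 A)}"
    have "Max (insert 0 A) \<in> insert 0 A"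
      using assms(1) by (intro Max_in) auto
    with i assms(3) show "i \<in> A" by auto
  qed
  moreover from this have "card A = Max (insert 0 A)"
    by (metis card_atLeastAtMost diff_Suc_1)
  ultimately show ?thesis by simp
qed

context pdp_thinning
begin

lemma rate_bound_pos: "0 < rate_bound D"
  using rate_pos rate_le less_le_trans by blast

lemma countable_modes: "countable (UNIV :: 'k set)"
proof -
  have "UNIV = mode D ` mode_indices TYPE('k)"
    using mode_enum by (simp add: bij_betw_def)
  then show ?thesis
    by (metis countable_image countableI_type)
qed

section \<open>Ordering and counting of the Poisson points\<close>

lemma Tstar_0: "\<omega> \<in> space (Pr D) \<Longrightarrow> Tstar D 0 \<omega> = 0"
  using poisson by (simp add: homogeneous_poisson_process_def)

lemma Tstar_less: "\<omega> \<in> space (Pr D) \<Longrightarrow> Tstar D i \<omega> < Tstar D j \<omega> \<longleftrightarrow> i < j"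
  using poisson strict_mono_less[of "\<lambda>j. Tstar D j \<omega>"]
  by (simp add: homogeneous_poisson_process_def)

lemma Tstar_le: "\<omega> \<in> space (Pr D) \<Longrightarrow> Tstar D i \<omega> \<le> Tstar D j \<omega> \<longleftrightarrow> i \<le> j"
  using Tstar_less[of \<omega> j i] by linarith

lemma finite_Tstar_le:
  "\<omega> \<in> space (Pr D) \<Longrightarrow> 0 \<le> t \<Longrightarrow> finite {j. 1 \<le> j \<and> Tstar D j \<omega> \<le> t}"
  using poisson by (simp add: homogeneous_poisson_process_def)

text \<open>As the points increase, those up to \<open>t\<close> form an initial segment of the
  indices whose length is \<open>Nstar D t \<omega>\<close>. Index 0 is treated apart: it is not
  counted, but its time is 0.\<close>

lemma Tstar_le_iff_Nstar:
  assumes "\<omega> \<in> space (Pr D)" and "0 \<le> t"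
  shows "Tstar D j \<omega> \<le> t \<longleftrightarrow> j \<le> Nstar D t \<omega>"
proof (cases "j = 0")
  case True
  with assms show ?thesis by (simp add: Tstar_0)
next
  case False
  define A where "A = {j. 1 \<le> j \<and> Tstar D j \<omega> \<le> t}"
  have "A = {1..card A}"
  proof (rule downclosed_eq_atLeastAtMost_card)
    show "finite A"
      unfolding A_def by (rule finite_Tstar_le[OF assms])
    fix i j assume "j \<in> A" "1 \<le> i" "i \<le> j"
    with Tstar_le[OF assms(1), of i j] show "i \<in> A" by (auto simp: A_def)
  qed (simp add: A_def)
  moreover have "Nstar D t \<omega> = card A"
    using poisson assms by (simp add: homogeneous_poisson_process_def A_def)
  ultimately have "j \<in> A \<longleftrightarrow> 1 \<le> j \<and> j \<le> Nstar D t \<omega>"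
    by (metis atLeastAtMost_iff)
  with False show ?thesis by (simp add: A_def)
qed

lemma Nstar_eq_iff:
  assumes "\<omega> \<in> space (Pr D)" and "0 \<le> t"
  shows "Nstar D t \<omega> = m \<longleftrightarrow> Tstar D m \<omega> \<le> t \<and> t < Tstar D (Suc m) \<omega>"
  using Tstar_le_iff_Nstar[OF assms, of m] Tstar_le_iff_Nstar[OF assms, of "Suc m"] by auto

lemma flow_at_eq: "0 \<le> s \<Longrightarrow> flow_at D (k, y) s = \<Phi> D k s y"
  by (simp add: flow_at_def)

section \<open>The thinning recursion along prescribed indices\<close>

lemma tau_Suc_eq_iff:
  "\<tau> D (Suc n) \<omega> = enat b \<longleftrightarrow>
     \<tau> D n \<omega> < enat b \<and>
     Useq D b \<omega> * rate_bound D
       \<le> rate D (\<theta> D n \<omega>, \<Phi> D (\<theta> D n \<omega>) (Tstar D b \<omega> - Tstar D (the_enat (\<tau> D n \<omega>)) \<omega>) (\<nu> D n \<omega>)) \<and>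
     (\<forall>j<b. \<tau> D n \<omega> < enat j \<longrightarrow>
        rate D (\<theta> D n \<omega>, \<Phi> D (\<theta> D n \<omega>) (Tstar D j \<omega> - Tstar D (the_enat (\<tau> D n \<omega>)) \<omega>) (\<nu> D n \<omega>))
        < Useq D j \<omega> * rate_bound D)"
  unfolding \<tau>.simps Inf_enat_eq_iff by (auto simp: not_le)

text \<open>Every candidate after \<open>a\<close> has positive elapsed time, so the truncation in
  \<open>flow_at\<close> is inactive.\<close>

lemma tau_Suc_iff_intensity:
  assumes \<omega>: "\<omega> \<in> space (Pr D)" and a: "\<tau> D n \<omega> = enat a" and "a < b"
  shows "\<tau> D (Suc n) \<omega> = enat b \<longleftrightarrow>
     Useq D b \<omega> * rate_bound D \<le> intensity D (\<theta> D n \<omega>, \<nu> D n \<omega>) (Tstar D b \<omega> - Tstar D a \<omega>) \<and>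
     (\<forall>j\<in>{a<..<b}. intensity D (\<theta> D n \<omega>, \<nu> D n \<omega>) (Tstar D j \<omega> - Tstar D a \<omega>) < Useq D j \<omega> * rate_bound D)"
proof -
  have "intensity D (\<theta> D n \<omega>, \<nu> D n \<omega>) (Tstar D j \<omega> - Tstar D a \<omega>)
      = rate D (\<theta> D n \<omega>, \<Phi> D (\<theta> D n \<omega>) (Tstar D j \<omega> - Tstar D a \<omega>) (\<nu> D n \<omega>))" if "a < j" for j
    using Tstar_less[OF \<omega>, of a j] that by (simp add: intensity_def flow_at_eq)
  with \<open>a < b\<close> show ?thesis
    unfolding tau_Suc_eq_iff a by auto
qed

text \<open>On this event the two recursions coincide; increasing \<open>p\<close> makes all elapsed
  times positive, so that the truncated flow is the true one.\<close>

lemma indexed_path_eq: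
  assumes \<omega>: "\<omega> \<in> space (Pr D)" and "\<And>i. i < n \<Longrightarrow> p i < p (Suc i)"
    and "\<And>i. i \<le> n \<Longrightarrow> \<tau> D i \<omega> = enat (p i)"
  shows "indexed_path D p (\<lambda>j. Tstar D j \<omega>) (\<lambda>j. Vseq D j \<omega>) n = (\<theta> D n \<omega>, \<nu> D n \<omega>)"
  using assms(2,3)
proof (induction n)
  case (Suc n)
  have "indexed_path D p (\<lambda>j. Tstar D j \<omega>) (\<lambda>j. Vseq D j \<omega>) n = (\<theta> D n \<omega>, \<nu> D n \<omega>)"
    using Suc by simp
  moreover have "\<tau> D n \<omega> = enat (p n)" "\<tau> D (Suc n) \<omega> = enat (p (Suc n))"
    using Suc.prems(2) by (metis Suc_leD order_refl)+
  moreover have "Tstar D (p n) \<omega> < Tstar D (p (Suc n)) \<omega>"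
    using Suc.prems(1) \<omega> by (simp add: Tstar_less)
  ultimately show ?case
    by (simp add: Let_def flow_at_eq del: \<tau>.simps)
qed simp

lemma tau_eq_iff_accepted:
  assumes \<omega>: "\<omega> \<in> space (Pr D)" and "p 0 = 0" and "\<And>i. i < n \<Longrightarrow> p i < p (Suc i)"
  shows "(\<forall>i\<le>n. \<tau> D i \<omega> = enat (p i)) \<longleftrightarrow>
    (\<forall>i<n. accepted D p (\<lambda>j. Tstar D j \<omega>) (\<lambda>j. Useq D j \<omega>) (\<lambda>j. Vseq D j \<omega>) i)"
  using assms(3)
proof (induction n)
  case 0
  show ?case by (simp add: \<open>p 0 = 0\<close> zero_enat_def)
next
  case (Suc n)
  \<comment> \<open>The two conditions at the new stage agree only under the earlier equalities,
    because only then does the prescribed path represent the process.\<close>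
  have "\<tau> D (Suc n) \<omega> = enat (p (Suc n)) \<longleftrightarrow>
      accepted D p (\<lambda>j. Tstar D j \<omega>) (\<lambda>j. Useq D j \<omega>) (\<lambda>j. Vseq D j \<omega>) n"
    if tau: "\<forall>i\<le>n. \<tau> D i \<omega> = enat (p i)"
  proof -
    have "indexed_path D p (\<lambda>j. Tstar D j \<omega>) (\<lambda>j. Vseq D j \<omega>) n = (\<theta> D n \<omega>, \<nu> D n \<omega>)"
      using tau Suc.prems by (intro indexed_path_eq[OF \<omega>]) auto
    moreover have "\<tau> D n \<omega> = enat (p n)" "p n < p (Suc n)"
      using tau Suc.prems by auto
    ultimately show ?thesis
      by (simp add: tau_Suc_iff_intensity[OF \<omega>] accepted_def del: \<tau>.simps)
  qed
  with Suc show ?case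
    by (auto simp: le_Suc_eq less_Suc_eq simp del: \<tau>.simps)
qed

section \<open>Jump times, the jump count and the state of the process\<close>

lemma jump_time_0: "\<omega> \<in> space (Pr D) \<Longrightarrow> jump_time D 0 \<omega> = 0"
  by (simp add: jump_time_def zero_enat_def Tstar_0)

text \<open>The second alternative is unavoidable: once \<open>\<tau>\<close> is infinite no
  candidate exceeds it, so infinity is absorbing.\<close>

lemma jump_time_Suc_less:
  assumes "\<omega> \<in> space (Pr D)"
  shows "jump_time D n \<omega> < jump_time D (Suc n) \<omega> \<or> jump_time D n \<omega> = \<infinity> \<and> jump_time D (Suc n) \<omega> = \<infinity>"
proof (cases "\<tau> D (Suc n) \<omega>")
  case (enat b)
  then have "\<tau> D n \<omega> < enat b"
    by (simp only: tau_Suc_eq_iff)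
  then obtain a where "\<tau> D n \<omega> = enat a" "a < b"
    by (cases "\<tau> D n \<omega>") auto
  with enat show ?thesis
    using assms by (simp add: jump_time_def Tstar_less del: \<tau>.simps)
next
  case infinity
  then show ?thesis
    by (cases "\<tau> D n \<omega>") (simp_all add: jump_time_def del: \<tau>.simps)
qed

lemma jump_time_mono: "\<omega> \<in> space (Pr D) \<Longrightarrow> i \<le> j \<Longrightarrow> jump_time D i \<omega> \<le> jump_time D j \<omega>"
  by (rule lift_Suc_mono_le[of "\<lambda>i. jump_time D i \<omega>"])
    (metis jump_time_Suc_less order_less_imp_le order_refl, simp_all)

lemma jump_time_strict:
  assumes "\<omega> \<in> space (Pr D)" "i < j" "jump_time D i \<omega> < \<infinity>"
  shows "jump_time D i \<omega> < jump_time D j \<omega>"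
proof -
  have "jump_time D i \<omega> < jump_time D (Suc i) \<omega>"
    using jump_time_Suc_less[OF assms(1), of i] assms(3) by auto
  also have "\<dots> \<le> jump_time D j \<omega>"
    using assms by (intro jump_time_mono) auto
  finally show ?thesis .
qed

text \<open>Each jump consumes at least one candidate, so \<open>n\<close> is at most
  \<open>\<tau> D n \<omega>\<close>. Non-accumulation thus passes from the Poisson points to the
  jump times.\<close>

lemma Tstar_le_jump_time:
  assumes "\<omega> \<in> space (Pr D)"
  shows "ereal (Tstar D n \<omega>) \<le> jump_time D n \<omega>"
proof -
  have "enat n \<le> \<tau> D n \<omega>"
  proof (induction n)
    case (Suc n)
    show ?case
    proof (cases "\<tau> D (Suc n) \<omega>")
      case (enat b)
      then have "\<tau> D n \<omega> < enat b"
        by (simp only: tau_Suc_eq_iff)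
      with Suc have "enat n < enat b"
        by (rule le_less_trans)
      with enat show ?thesis
        by (simp add: Suc_le_eq del: \<tau>.simps)
    qed (simp del: \<tau>.simps)
  qed (simp add: zero_enat_def)
  with assms show ?thesis
    by (cases "\<tau> D n \<omega>") (simp_all add: jump_time_def Tstar_le)
qed

text \<open>The indices of jumps up to \<open>t\<close> form an initial segment by monotonicity,
  finite by comparison with the Poisson points; its length is the jump count.\<close>

lemma jump_count_eq_iff:
  assumes \<omega>: "\<omega> \<in> space (Pr D)" and "0 \<le> t"
  shows "jump_count D t \<omega> = n \<longleftrightarrow> jump_time D n \<omega> \<le> ereal t \<and> ereal t < jump_time D (Suc n) \<omega>"
proof -
  define A where "A = {n. 1 \<le> n \<and> jump_time D n \<omega> \<le> ereal t}"
  have "A = {1..card A}"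
  proof (rule downclosed_eq_atLeastAtMost_card)
    have "A \<subseteq> {j. 1 \<le> j \<and> Tstar D j \<omega> \<le> t}"
    proof
      fix j assume "j \<in> A"
      then have "1 \<le> j" "jump_time D j \<omega> \<le> ereal t"
        by (auto simp: A_def)
      moreover from this have "ereal (Tstar D j \<omega>) \<le> ereal t"
        using Tstar_le_jump_time[OF \<omega>, of j] by (blast intro: order_trans)
      ultimately show "j \<in> {j. 1 \<le> j \<and> Tstar D j \<omega> \<le> t}" by simp
    qed
    then show "finite A"
      using finite_Tstar_le[OF assms] by (rule finite_subset)
    fix i j assume "j \<in> A" "1 \<le> i" "i \<le> j"
    then show "i \<in> A"
      using jump_time_mono[OF \<omega>, of i j] by (auto simp: A_def intro: order_trans)
  qed (simp add: A_def)
  then have "j \<in> A \<longleftrightarrow> 1 \<le> j \<and> j \<le> card A" for j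
    by (metis atLeastAtMost_iff)
  then have "1 \<le> j \<Longrightarrow> jump_time D j \<omega> \<le> ereal t \<longleftrightarrow> j \<le> card A" for j
    unfolding A_def by blast
  \<comment> \<open>For \<open>j = 0\<close> both sides hold, since the zeroth jump time is 0 and
    \<open>t\<close> is nonnegative.\<close>
  then have le_iff: "jump_time D j \<omega> \<le> ereal t \<longleftrightarrow> j \<le> card A" for j
    using \<open>0 \<le> t\<close> \<omega> by (cases "j = 0") (auto simp: jump_time_0)
  have "jump_count D t \<omega> = card A"
    by (simp add: jump_count_def A_def)
  with le_iff[of n] le_iff[of "Suc n"] show ?thesis
    by auto
qed

text \<open>Any index whose interval contains \<open>t\<close> equals the jump count, so the
  description in \<open>pdp\<close> is unique. Positivity of \<open>t\<close> avoids the separate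
  clause at time 0.\<close>

lemma pdp_eq:
  assumes "\<omega> \<in> space (Pr D)" "0 < t" "jump_count D t \<omega> = n"
  shows "pdp D t \<omega> = (\<theta> D n \<omega>, \<Phi> D (\<theta> D n \<omega>) (t - real_of_ereal (jump_time D n \<omega>)) (\<nu> D n \<omega>))"
proof -
  have "(THE n. jump_time D n \<omega> \<le> ereal t \<and> ereal t < jump_time D (Suc n) \<omega>) = n"
    using assms by (intro the_equality) (auto simp: jump_count_eq_iff[symmetric])
  with assms show ?thesis
    by (simp add: pdp_def)
qed

text \<open>Finite jump times are strictly increasing, so a given time is the jump time of at most
  one index.\<close>

lemma pdp_minus_eq:
  assumes "\<omega> \<in> space (Pr D)" "1 \<le> n" "\<tau> D n \<omega> = enat j"
  shows "pdp_minus D (Tstar D j \<omega>) \<omega> = (\<theta> D (n - 1) \<omega>, \<nu> D n \<omega>)"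
proof -
  have n: "jump_time D n \<omega> = ereal (Tstar D j \<omega>)"
    using assms by (simp add: jump_time_def)
  have "(THE n. 1 \<le> n \<and> jump_time D n \<omega> = ereal (Tstar D j \<omega>)) = n"
  proof (rule the_equality)
    fix i assume i: "1 \<le> i \<and> jump_time D i \<omega> = ereal (Tstar D j \<omega>)"
    show "i = n"
      using jump_time_strict[OF assms(1), of i n] jump_time_strict[OF assms(1), of n i] i n
      by (cases i n rule: linorder_cases) auto
  qed (use assms n in auto)
  then show ?thesis
    by (simp add: pdp_minus_def)
qed

end

section \<open>The mode kernel and measurability\<close>

context pdp_thinning
begin

lemma sets_kernel: "sets (kernel D x) = sets state_space"
  and prob_space_kernel: "prob_space (kernel D x)"
proof -
  have "kernel D x \<in> space (prob_algebra state_space)"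
    using kernel by (rule measurable_space) (simp add: space_pair_measure)
  then show "sets (kernel D x) = sets state_space" "prob_space (kernel D x)"
    by (auto simp: space_prob_algebra)
qed

lemma mode_cylinder: "A \<times> UNIV \<in> sets (state_space :: ('k \<times> real) measure)"
  by (intro pair_measureI) auto

lemma Q_mode_nonneg: "0 \<le> Q_mode D x k"
  by (simp add: Q_mode_def)

lemma Q_mode_le_1: "Q_mode D x k \<le> 1"
  unfolding Q_mode_def by (rule prob_space.prob_le_1[OF prob_space_kernel])

section \<open>Partial sums of the mode probabilities\<close>

lemma a_sum_0: "a_sum D 0 x = 0"
  by (simp add: a_sum_def)

lemma a_sum_mono: "i \<le> j \<Longrightarrow> a_sum D i x \<le> a_sum D j x"
  unfolding a_sum_def by (intro sum_mono2) (auto intro: Q_mode_nonneg)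

lemma a_sum_step:
  assumes "i \<in> mode_indices TYPE('k)"
  shows "a_sum D i x = a_sum D (i - 1) x + Q_mode D x (mode D i)"
proof -
  have "1 \<le> i"
    using assms by (simp add: mode_indices_def)
  then have "{1..i} \<inter> mode_indices TYPE('k) = insert i ({1..i - 1} \<inter> mode_indices TYPE('k))"
    using assms by auto
  moreover have "i \<notin> {1..i - 1} \<inter> mode_indices TYPE('k)"
    using \<open>1 \<le> i\<close> by auto
  ultimately show ?thesis
    by (simp add: a_sum_def del: One_nat_def)
qed

text \<open>Injectivity of the enumeration makes the cylinders over single modes disjoint. Bounds
  and the limit of the partial sums then follow from properties of a probability measure.\<close>

lemma a_sum_eq_measure:
  "a_sum D j x = measure (kernel D x) (mode D ` ({1..j} \<inter> mode_indices TYPE('k)) \<times> UNIV)"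
proof -
  interpret K: prob_space "kernel D x"
    by (rule prob_space_kernel)
  let ?I = "{1..j} \<inter> mode_indices TYPE('k)"
  have inj: "inj_on (mode D) (mode_indices TYPE('k))"
    using mode_enum by (rule bij_betw_imp_inj_on)
  have "measure (kernel D x) (\<Union>i\<in>?I. {mode D i} \<times> UNIV) = (\<Sum>i\<in>?I. measure (kernel D x) ({mode D i} \<times> UNIV))"
    using inj by (intro K.finite_measure_finite_Union)
      (auto simp: disjoint_family_on_def sets_kernel inj_on_def intro!: mode_cylinder)
  moreover have "(\<Union>i\<in>?I. {mode D i} \<times> (UNIV :: real set)) = mode D ` ?I \<times> UNIV"
    by auto
  ultimately show ?thesis
    by (simp only: a_sum_def Q_mode_def)
qed

lemma a_sum_le_1: "a_sum D j x \<le> 1"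
  unfolding a_sum_eq_measure by (rule prob_space.prob_le_1[OF prob_space_kernel])

lemma a_sum_nonneg: "0 \<le> a_sum D j x"
  unfolding a_sum_eq_measure by (rule measure_nonneg)

text \<open>Continuity from below: since the enumeration is onto, the cylinders over its initial
  segments exhaust the state space.\<close>

lemma a_sum_tendsto: "(\<lambda>j. a_sum D j x) \<longlonglongrightarrow> 1"
proof -
  interpret K: prob_space "kernel D x"
    by (rule prob_space_kernel)
  let ?B = "\<lambda>j. mode D ` ({1..j} \<inter> mode_indices TYPE('k)) \<times> (UNIV :: real set)"
  have "(\<lambda>j. measure (kernel D x) (?B j)) \<longlonglongrightarrow> measure (kernel D x) (\<Union>j. ?B j)"
    by (rule K.finite_Lim_measure_incseq) (auto simp: incseq_def sets_kernel intro: mode_cylinder)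
  moreover have "(\<Union>j. ?B j) = space (kernel D x)"
  proof -
    have "space (kernel D x) = UNIV"
      using sets_eq_imp_space_eq[OF sets_kernel] by (simp add: space_pair_measure)
    moreover have "y \<in> (\<Union>j. ?B j)" for y :: "'k \<times> real"
    proof -
      have "fst y \<in> mode D ` mode_indices TYPE('k)"
        using mode_enum by (simp add: bij_betw_def)
      then obtain i where "i \<in> mode_indices TYPE('k)" "fst y = mode D i"
        by blast
      then have "y \<in> ?B i"
        by (cases y) (auto simp: mode_indices_def)
      then show ?thesis by blast
    qed
    ultimately show ?thesis by blast
  qed
  ultimately show ?thesis
    by (simp add: a_sum_eq_measure K.prob_space)
qed

section \<open>Choosing the mode by a uniform variable\<close>

definition in_cell :: "'k \<times> real \<Rightarrow> real \<Rightarrow> nat \<Rightarrow> bool" where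
  "in_cell x u i \<longleftrightarrow> a_sum D (i - 1) x < u \<and> u \<le> a_sum D i x"

text \<open>For \<open>i < j\<close> monotonicity of the partial sums puts the right end of cell
  \<open>i\<close> at or before the left end of cell \<open>j\<close>.\<close>

lemma in_cell_unique:
  assumes "1 \<le> i" "1 \<le> j" "in_cell x u i" "in_cell x u j"
  shows "i = j"
proof (rule ccontr)
  assume "i \<noteq> j"
  then consider "i \<le> j - 1" | "j \<le> i - 1"
    using assms by linarith
  then show False
    using assms a_sum_mono[of i "j - 1" x] a_sum_mono[of j "i - 1" x]
    by cases (auto simp: in_cell_def)
qed

lemma H_mode_in_cell:
  assumes "i \<in> mode_indices TYPE('k)" "in_cell x u i"
  shows "H_mode D x u = mode D i"
proof -
  have "(THE i. i \<in> mode_indices TYPE('k) \<and> in_cell x u i) = i"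
    using assms by (intro the_equality) (auto simp: mode_indices_def intro: in_cell_unique[of _ _ x u])
  with assms show ?thesis
    by (auto simp: H_mode_def in_cell_def)
qed

lemma H_mode_no_cell: "\<not> (\<exists>i\<in>mode_indices TYPE('k). in_cell x u i) \<Longrightarrow> H_mode D x u = mode D 1"
  by (auto simp: H_mode_def in_cell_def)

text \<open>The cell is that of the least index whose partial sum reaches \<open>u\<close>. Such an
  index exists because the sums tend to 1, and it is not 0 because the zeroth sum vanishes.\<close>

lemma ex_in_cell:
  assumes "0 < u" "u < 1"
  shows "\<exists>i\<in>mode_indices TYPE('k). in_cell x u i"
proof -
  have "\<forall>\<^sub>F j in sequentially. u < a_sum D j x"
    using a_sum_tendsto assms(2) by (rule order_tendstoD)
  then obtain j where "u < a_sum D j x"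
    by (auto simp: eventually_sequentially)
  define i where "i = (LEAST j. u \<le> a_sum D j x)"
  have i: "u \<le> a_sum D i x"
    using LeastI[of "\<lambda>j. u \<le> a_sum D j x" j] \<open>u < a_sum D j x\<close> by (simp add: i_def)
  then have "i \<noteq> 0"
    using assms(1) by (metis a_sum_0 not_less)
  then have less: "a_sum D (i - 1) x < u"
    using not_less_Least[of "i - 1" "\<lambda>j. u \<le> a_sum D j x"] unfolding i_def[symmetric] by simp
  \<comment> \<open>At an index that enumerates no mode the partial sum does not grow, yet it has
    just crossed \<open>u\<close>.\<close>
  have "i \<in> mode_indices TYPE('k)"
  proof (rule ccontr)
    assume "i \<notin> mode_indices TYPE('k)"
    then have "j \<noteq> i" if "j \<in> mode_indices TYPE('k)" for j
      using that by blast
    then have "{1..i} \<inter> mode_indices TYPE('k) = {1..i - 1} \<inter> mode_indices TYPE('k)"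
      by fastforce
    then have "a_sum D i x = a_sum D (i - 1) x"
      by (simp add: a_sum_def)
    with i less show False by simp
  qed
  with i less show ?thesis
    by (auto simp: in_cell_def)
qed

lemma obtain_mode_index:
  obtains i where "i \<in> mode_indices TYPE('k)" "mode D i = k"
proof -
  have "k \<in> mode D ` mode_indices TYPE('k)"
    using mode_enum by (simp add: bij_betw_def)
  then show ?thesis using that by blast
qed

text \<open>Exact for every \<open>u\<close>, including those in no cell, where the fallback assigns
  the first mode; measurability requires this rather than an almost sure description.\<close>

lemma H_mode_eq_iff:
  assumes "i \<in> mode_indices TYPE('k)"
  shows "H_mode D x u = mode D i \<longleftrightarrow>
    in_cell x u i \<or> (i = 1 \<and> (\<forall>j\<in>mode_indices TYPE('k). \<not> in_cell x u j))"
proof -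
  have inj: "inj_on (mode D) (mode_indices TYPE('k))"
    using mode_enum by (rule bij_betw_imp_inj_on)
  have "1 \<in> mode_indices TYPE('k)"
    using assms by (auto simp: mode_indices_def)
  show ?thesis
  proof (cases "\<exists>j\<in>mode_indices TYPE('k). in_cell x u j")
    case True
    then obtain j where j: "j \<in> mode_indices TYPE('k)" "in_cell x u j"
      by blast
    then have "H_mode D x u = mode D i \<longleftrightarrow> j = i"
      using inj assms by (auto simp: H_mode_in_cell inj_on_def)
    then show ?thesis
      using j assms in_cell_unique[of j i x u] by (auto simp: mode_indices_def)
  next
    case False
    then show ?thesis
      using inj assms \<open>1 \<in> mode_indices TYPE('k)\<close> by (auto simp: H_mode_no_cell inj_on_def)
  qed
qed

section \<open>Measurability of the mode choice, the flow and the path\<close>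

lemma measurable_Q_mode[measurable (raw)]:
  assumes X: "X \<in> N \<rightarrow>\<^sub>M state_space"
  shows "(\<lambda>x. Q_mode D (X x) k) \<in> borel_measurable N"
  unfolding Q_mode_def
  by (rule measurable_compose[OF measurable_compose[OF X kernel] measurable_measure_prob_algebra])
    (rule mode_cylinder)

lemma measurable_a_sum[measurable (raw)]:
  assumes [measurable]: "X \<in> N \<rightarrow>\<^sub>M state_space"
  shows "(\<lambda>x. a_sum D j (X x)) \<in> borel_measurable N"
  unfolding a_sum_def by measurable

lemma measurable_in_cell[measurable (raw)]:
  assumes [measurable]: "X \<in> N \<rightarrow>\<^sub>M state_space" "u \<in> borel_measurable N"
  shows "Measurable.pred N (\<lambda>x. in_cell (X x) (u x) i)"
  unfolding in_cell_def by measurable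

text \<open>The modes are countable, so preimages of singletons suffice, and these are described by
  cells.\<close>

lemma measurable_H_mode[measurable (raw)]:
  assumes [measurable]: "X \<in> N \<rightarrow>\<^sub>M state_space" "u \<in> borel_measurable N"
  shows "(\<lambda>x. H_mode D (X x) (u x)) \<in> N \<rightarrow>\<^sub>M count_space UNIV"
proof -
  have "(\<lambda>x. H_mode D (X x) (u x)) -` {k} \<inter> space N \<in> sets N" for k
  proof -
    obtain i where i: "i \<in> mode_indices TYPE('k)" "mode D i = k"
      by (rule obtain_mode_index)
    have "(\<lambda>x. H_mode D (X x) (u x)) -` {k} \<inter> space N =
      {x\<in>space N. in_cell (X x) (u x) i \<or> (i = 1 \<and> (\<forall>j\<in>mode_indices TYPE('k). \<not> in_cell (X x) (u x) j))}"
      unfolding i(2)[symmetric] by (simp only: vimage_def Int_def singleton_iff mem_Collect_eq H_mode_eq_iff[OF i(1)] conj_commute)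
    also have "\<dots> \<in> sets N"
      by measurable
    finally show ?thesis .
  qed
  then show ?thesis
    by (simp add: measurable_count_space_eq_countable[OF countable_modes])
qed

text \<open>Almost every \<open>u\<close> lies strictly between 0 and 1, where choosing
  \<open>k\<close> means falling in the cell of \<open>k\<close>; the length of that cell is the
  kernel probability.\<close>

lemma integral_H_mode: "(\<integral>u. of_bool (H_mode D x u = k) \<partial>uniform01) = Q_mode D x k"
proof -
  interpret U: prob_space uniform01
    by (rule prob_space_uniform01)
  obtain i where i: "i \<in> mode_indices TYPE('k)" "mode D i = k"
    by (rule obtain_mode_index)
  have inj: "inj_on (mode D) (mode_indices TYPE('k))"
    using mode_enum by (rule bij_betw_imp_inj_on)
  let ?C = "{a_sum D (i - 1) x<..a_sum D i x}"
  have cell: "H_mode D x u = k \<longleftrightarrow> u \<in> ?C" if u: "0 < u" "u < 1" for u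
  proof -
    obtain j where j: "j \<in> mode_indices TYPE('k)" "in_cell x u j"
      using ex_in_cell[OF u] by blast
    have "H_mode D x u = k \<longleftrightarrow> mode D j = mode D i"
      using H_mode_in_cell[OF j] i by simp
    also have "\<dots> \<longleftrightarrow> j = i"
      using inj i j by (auto simp: inj_on_def)
    also have "\<dots> \<longleftrightarrow> in_cell x u i"
      using j i in_cell_unique[of j i x u] by (auto simp: mode_indices_def)
    finally show ?thesis
      by (simp add: in_cell_def)
  qed
  \<comment> \<open>The endpoints are discarded: 0 lies in no cell, and 1 may lie in none if the
    partial sums never reach 1.\<close>
  have "AE u in lborel. u \<noteq> (0::real) \<and> u \<noteq> 1"
    by (intro AE_conjI AE_lborel_singleton)
  then have "AE u in uniform01. 0 < u \<and> u < (1::real)"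
    by (intro AE_uniform_measureI) auto
  then have AE: "AE u in uniform01. of_bool (H_mode D x u = k) = indicat_real ?C u"
    by eventually_elim (simp add: cell indicator_def)
  have [measurable]: "(\<lambda>u. H_mode D x u) \<in> borel \<rightarrow>\<^sub>M count_space UNIV"
    by (intro measurable_H_mode) (simp_all add: space_pair_measure)
  have "(\<integral>u. of_bool (H_mode D x u = k) \<partial>uniform01) = (\<integral>u. indicat_real ?C u \<partial>uniform01)"
    using AE by (rule integral_cong_AE[rotated 2]) measurable
  also have "\<dots> = measure uniform01 ?C"
    by simp
  also have "\<dots> = a_sum D i x - a_sum D (i - 1) x"
    by (intro measure_uniform01_Ioc a_sum_nonneg a_sum_le_1 a_sum_mono) simp
  also have "\<dots> = Q_mode D x k"
    using a_sum_step[OF i(1)] i(2) by simp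
  finally show ?thesis .
qed

text \<open>Measurability is assumed for each mode separately and on nonnegative times. Truncation
  provides the latter, and countability of the modes glues the pieces together.\<close>

lemma measurable_flow_at[measurable (raw)]:
  assumes [measurable]: "X \<in> N \<rightarrow>\<^sub>M state_space" "s \<in> borel_measurable N"
  shows "(\<lambda>x. flow_at D (X x) (s x)) \<in> borel_measurable N"
proof -
  have "(\<lambda>x. \<Phi> D k (max 0 (s x)) (snd (X x))) \<in> borel_measurable N" for k
  proof -
    have "(\<lambda>x. (max 0 (s x), snd (X x))) \<in> N \<rightarrow>\<^sub>M restrict_space borel ({0..} \<times> UNIV)"
      by (rule measurable_restrict_space2) (simp_all flip: borel_prod)
    from measurable_compose[OF this flow_measurable[of k]] show ?thesis
      by simp
  qed
  moreover have "(\<lambda>x. fst (X x)) \<in> N \<rightarrow>\<^sub>M count_space UNIV"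
    by measurable
  ultimately show ?thesis
    unfolding flow_at_def by (rule measurable_compose_countable'[OF _ _ countable_modes])
qed

lemma measurable_rate[measurable (raw)]:
  "X \<in> N \<rightarrow>\<^sub>M state_space \<Longrightarrow> (\<lambda>x. rate D (X x)) \<in> borel_measurable N"
  using rate_measurable by (rule measurable_compose[rotated])

lemma measurable_intensity[measurable (raw)]:
  assumes [measurable]: "X \<in> N \<rightarrow>\<^sub>M state_space" "s \<in> borel_measurable N"
  shows "(\<lambda>x. intensity D (X x) (s x)) \<in> borel_measurable N"
  unfolding intensity_def by measurable

lemma measurable_indexed_path[measurable (raw)]:
  assumes T[measurable]: "\<And>j. (\<lambda>x. T x j) \<in> borel_measurable N"
    and V[measurable]: "\<And>j. (\<lambda>x. V x j) \<in> borel_measurable N"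
  shows "(\<lambda>x. indexed_path D p (T x) (V x) i) \<in> N \<rightarrow>\<^sub>M state_space"
proof (induction i)
  case (Suc i)
  note [measurable] = Suc
  show ?case
    unfolding indexed_path.simps Let_def by measurable
qed simp

lemma measurable_accepted[measurable (raw)]:
  assumes [measurable]: "\<And>j. (\<lambda>x. T x j) \<in> borel_measurable N"
    "\<And>j. (\<lambda>x. U x j) \<in> borel_measurable N" "\<And>j. (\<lambda>x. V x j) \<in> borel_measurable N"
  shows "Measurable.pred N (\<lambda>x. accepted D p (T x) (U x) (V x) i)"
  unfolding accepted_def by measurable

end

section \<open>Integrating out the uniform variables\<close>

text \<open>The factor that reads neither \<open>V n\<close> nor any uniform after candidate
  \<open>p n\<close>; the prescribed \<open>k\<close> stands in for the mode after the last jump.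
  The event \<open>Nstar = m\<close> is written through \<open>T\<close>, so that only the three
  driving sequences occur.\<close>

definition history_weight ::
    "('k, 'w) thinning_data \<Rightarrow> ('k \<times> real \<Rightarrow> real) \<Rightarrow> real \<Rightarrow> (nat \<Rightarrow> nat) \<Rightarrow> nat \<Rightarrow> nat \<Rightarrow> 'k \<Rightarrow>
     (nat \<Rightarrow> real) \<Rightarrow> (nat \<Rightarrow> real) \<Rightarrow> (nat \<Rightarrow> real) \<Rightarrow> real" where
  "history_weight D g t p n m k T U V =
     g (k, flow_at D (k, snd (indexed_path D p T V n)) (t - T (p n))) *
     of_bool ((\<forall>i<n. accepted D p T U V i) \<and> T m \<le> t \<and> t < T (Suc m))"

text \<open>The ratio of the intensity to its bound at candidate \<open>q\<close>, computed with the
  prescribed mode so that \<open>V n\<close> does not enter.\<close>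

definition accept_prob ::
    "('k, 'w) thinning_data \<Rightarrow> (nat \<Rightarrow> nat) \<Rightarrow> nat \<Rightarrow> 'k \<Rightarrow> (nat \<Rightarrow> real) \<Rightarrow> (nat \<Rightarrow> real) \<Rightarrow> nat \<Rightarrow> real" where
  "accept_prob D p n k T V q = intensity D (k, snd (indexed_path D p T V n)) (T q - T (p n)) / rate_bound D"

text \<open>The value \<open>p 0 = 0\<close> encodes \<open>\<tau>\<^sub>0 = 0\<close>.\<close>

definition strict_mono_upto :: "nat \<Rightarrow> (nat \<Rightarrow> nat) \<Rightarrow> bool" where
  "strict_mono_upto n p \<longleftrightarrow> p 0 = 0 \<and> (\<forall>i<n. p i < p (Suc i))"

lemma strict_mono_upto_le:
  assumes "strict_mono_upto n p" "i \<le> j" "j \<le> n"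
  shows "p i \<le> p j"
  using assms(2,3)
proof (induction j rule: dec_induct)
  case (step j)
  then have "p j < p (Suc j)"
    using assms(1) by (auto simp: strict_mono_upto_def)
  with step show ?case by simp
qed simp

lemma strict_mono_upto_ge:
  assumes "strict_mono_upto n p" "i \<le> n"
  shows "i \<le> p i"
  using assms(2)
proof (induction i)
  case (Suc i)
  then have "p i < p (Suc i)"
    using assms(1) by (auto simp: strict_mono_upto_def)
  with Suc show ?case by simp
qed simp

text \<open>All stages \<open>i < n\<close> stop at or before \<open>p n\<close>, and the position
  at the \<open>n\<close>-th jump precedes the draw of \<open>V n\<close>.\<close>

lemma history_weight_cong:
  assumes p: "strict_mono_upto n p"
    and V: "\<And>j. 1 \<le> j \<Longrightarrow> j < n \<Longrightarrow> V j = V' j"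
    and U: "\<And>j. 1 \<le> j \<Longrightarrow> j \<le> p n \<Longrightarrow> U j = U' j"
  shows "history_weight D g t p n m k T U V = history_weight D g t p n m k T U' V'"
proof -
  have "snd (indexed_path D p T V n) = snd (indexed_path D p T V' n)"
    using V by (rule snd_indexed_path_cong)
  moreover have "accepted D p T U V i = accepted D p T U' V' i" if "i < n" for i
  proof (rule accepted_cong)
    show "p i < p (Suc i)"
      using p that by (simp add: strict_mono_upto_def)
    have "p (Suc i) \<le> p n"
      using that by (intro strict_mono_upto_le[OF p]) auto
    then show "U j = U' j" if "1 \<le> j" "j \<le> p (Suc i)" for j
      using that by (intro U) auto
  qed (use that V in auto)
  ultimately show ?thesis
    by (simp add: history_weight_def)
qed

lemma accept_prob_cong:
  assumes "\<And>j. 1 \<le> j \<Longrightarrow> j < n \<Longrightarrow> V j = V' j"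
  shows "accept_prob D p n k T V q = accept_prob D p n k T V' q"
  unfolding accept_prob_def by (simp only: snd_indexed_path_cong[OF assms])

lemma abs_mult_unit_le:
  fixes a b C :: real
  assumes "\<bar>a\<bar> \<le> C" "0 \<le> b" "b \<le> 1"
  shows "\<bar>a * b\<bar> \<le> C"
proof -
  have "\<bar>a\<bar> * b \<le> \<bar>a\<bar> * 1"
    using assms by (intro mult_left_mono) auto
  with assms show ?thesis by (simp add: abs_mult)
qed

lemma integral_uniform01_of_bool_less:
  assumes "0 \<le> c" "c \<le> 1"
  shows "(\<integral>u. of_bool (c < u) \<partial>uniform01) = 1 - c"
proof -
  have "(\<lambda>u. of_bool (c < u) :: real) = indicat_real {c<..}"
    by (auto simp: indicator_def)
  then show ?thesis
    by (simp only: Bochner_Integration.integral_indicator space_uniform_measure space_lborel space_borel Int_UNIV_right measure_uniform01_Ioi[OF assms])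
qed

context pdp_thinning
begin

lemma measurable_history_weight[measurable (raw)]:
  assumes [measurable]: "g \<in> borel_measurable state_space"
    "\<And>j. (\<lambda>x. T x j) \<in> borel_measurable N"
    "\<And>j. (\<lambda>x. U x j) \<in> borel_measurable N" "\<And>j. (\<lambda>x. V x j) \<in> borel_measurable N"
  shows "(\<lambda>x. history_weight D g t p n m k (T x) (U x) (V x)) \<in> borel_measurable N"
  unfolding history_weight_def by measurable

lemma measurable_accept_prob[measurable (raw)]:
  assumes [measurable]: "\<And>j. (\<lambda>x. T x j) \<in> borel_measurable N" "\<And>j. (\<lambda>x. V x j) \<in> borel_measurable N"
  shows "(\<lambda>x. accept_prob D p n k (T x) (V x) q) \<in> borel_measurable N"
  unfolding accept_prob_def by measurable

lemma accept_prob_nonneg: "0 \<le> accept_prob D p n k T V q"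
  using rate_pos rate_bound_pos by (auto simp: accept_prob_def intensity_def less_imp_le)

lemma accept_prob_le_1: "accept_prob D p n k T V q \<le> 1"
  using rate_le rate_bound_pos by (simp add: accept_prob_def intensity_def)

lemma abs_history_weight_le:
  assumes "\<And>x. \<bar>g x\<bar> \<le> C"
  shows "\<bar>history_weight D g t p n m k T U V\<bar> \<le> C"
  unfolding history_weight_def by (rule abs_mult_unit_le) (auto simp: assms)

section \<open>The joint law of the driving sequences\<close>

lemma distr_iid_uniform:
  assumes "iid_uniform (Pr D) X" "1 \<le> m"
  shows "distr (Pr D) (PiM {1..m} (\<lambda>_. borel)) (\<lambda>\<omega>. \<lambda>j\<in>{1..m}. X j \<omega>) = PiM {1..m} (\<lambda>_. uniform01)"
proof -
  have indep: "indep_vars (\<lambda>_. borel) X {1..m}"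
    by (rule indep_vars_subset[of _ X "{1..}"]) (use assms in \<open>auto simp: iid_uniform_def\<close>)
  then have "distr (Pr D) (PiM {1..m} (\<lambda>_. borel)) (\<lambda>\<omega>. \<lambda>j\<in>{1..m}. X j \<omega>)
      = PiM {1..m} (\<lambda>j. distr (Pr D) borel (X j))"
    using assms(2) by (subst indep_vars_iff_distr_eq_PiM'[symmetric]) (auto simp: indep_vars_def)
  also have "\<dots> = PiM {1..m} (\<lambda>_. uniform01)"
    using assms(1) by (intro PiM_cong) (auto simp: iid_uniform_def)
  finally show ?thesis .
qed

abbreviation driving_space :: "nat \<Rightarrow> nat \<Rightarrow> ((nat \<Rightarrow> real) \<times> (nat \<Rightarrow> real) \<times> (nat \<Rightarrow> real)) measure" where
  "driving_space m n \<equiv>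
     PiM UNIV (\<lambda>_. borel) \<Otimes>\<^sub>M (PiM {1..m} (\<lambda>_. borel) \<Otimes>\<^sub>M PiM {1..n} (\<lambda>_. borel))"

text \<open>The uniforms are cut to the finite blocks that a term reads, whose laws are products of
  uniform laws. The Poisson times are kept whole, since their law is never computed.\<close>

definition driving :: "nat \<Rightarrow> nat \<Rightarrow> 'w \<Rightarrow> (nat \<Rightarrow> real) \<times> (nat \<Rightarrow> real) \<times> (nat \<Rightarrow> real)" where
  "driving m n \<omega> = (\<lambda>j. Tstar D j \<omega>, \<lambda>j\<in>{1..m}. Useq D j \<omega>, \<lambda>j\<in>{1..n}. Vseq D j \<omega>)"

lemma measurable_driving[measurable]: "driving m n \<in> Pr D \<rightarrow>\<^sub>M driving_space m n"
proof -
  have [measurable]: "Tstar D j \<in> borel_measurable (Pr D)" for j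
    using poisson by (simp add: homogeneous_poisson_process_def)
  have U: "Useq D j \<in> borel_measurable (Pr D)" if "1 \<le> j" for j
    using U_uniform that by (auto simp: iid_uniform_def indep_vars_def)
  have V: "Vseq D j \<in> borel_measurable (Pr D)" if "1 \<le> j" for j
    using V_uniform that by (auto simp: iid_uniform_def indep_vars_def)
  have "(\<lambda>\<omega> j. Tstar D j \<omega>) \<in> Pr D \<rightarrow>\<^sub>M PiM UNIV (\<lambda>_. borel)"
    by (rule measurable_PiM_single') (auto simp: space_PiM)
  moreover have "(\<lambda>\<omega>. \<lambda>j\<in>{1..m}. Useq D j \<omega>) \<in> Pr D \<rightarrow>\<^sub>M PiM {1..m} (\<lambda>_. borel)"
    by (rule measurable_restrict) (auto intro: U)
  moreover have "(\<lambda>\<omega>. \<lambda>j\<in>{1..n}. Vseq D j \<omega>) \<in> Pr D \<rightarrow>\<^sub>M PiM {1..n} (\<lambda>_. borel)"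
    by (rule measurable_restrict) (auto intro: V)
  ultimately show ?thesis
    unfolding driving_def[abs_def] by (intro measurable_Pair)
qed

lemma distr_driving:
  assumes "1 \<le> m" "1 \<le> n"
  shows "distr (Pr D) (driving_space m n) (driving m n) =
    distr (Pr D) (PiM UNIV (\<lambda>_. borel)) (\<lambda>\<omega> j. Tstar D j \<omega>) \<Otimes>\<^sub>M
    (PiM {1..m} (\<lambda>_. uniform01) \<Otimes>\<^sub>M PiM {1..n} (\<lambda>_. uniform01))"
proof -
  define N :: "nat \<Rightarrow> (nat \<Rightarrow> real) measure" where
    "N i = [PiM UNIV (\<lambda>_. borel), PiM {1..m} (\<lambda>_. borel), PiM {1..n} (\<lambda>_. borel)] ! i" for i
  \<comment> \<open>The independence assumption covers indices from 1 on; coordinate 0 of the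
    Poisson times is restored as the constant 0, its actual value.\<close>
  define Y :: "nat \<Rightarrow> (nat \<Rightarrow> real) \<Rightarrow> nat \<Rightarrow> real" where
    "Y i x = [\<lambda>j. if j = 0 then 0 else x j, restrict x {1..m}, restrict x {1..n}] ! i" for i x
  define Z where "Z i \<omega> = Y i (\<lambda>j\<in>{1..}. ([Tstar D, Useq D, Vseq D] ! i) j \<omega>)" for i \<omega>
  have Y_meas: "Y i \<in> PiM {1..} (\<lambda>_. borel) \<rightarrow>\<^sub>M N i" if "i \<in> {..<3}" for i
  proof -
    have "(\<lambda>x j. if j = 0 then 0 else x j) \<in> PiM {1..} (\<lambda>_. borel) \<rightarrow>\<^sub>M PiM UNIV (\<lambda>_::nat. borel :: real measure)"
    proof (rule measurable_PiM_single')
      show "(\<lambda>x. if j = 0 then 0 else x j) \<in> PiM {1..} (\<lambda>_. borel) \<rightarrow>\<^sub>M (borel :: real measure)" for j :: nat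
        by (cases "j = 0") auto
    qed (auto simp: space_PiM)
    moreover have "i = 0 \<or> i = 1 \<or> i = 2"
      using that by auto
    ultimately show ?thesis
      by (elim disjE) (simp_all add: Y_def[abs_def] N_def measurable_restrict_subset)
  qed
  have "indep_vars N Z {..<3}"
    unfolding Z_def[abs_def] by (rule indep_vars_compose2[OF independent Y_meas])
  from distr_three_indep[OF this]
  have "distr (Pr D) (driving_space m n) (\<lambda>\<omega>. (Z 0 \<omega>, Z 1 \<omega>, Z 2 \<omega>)) =
      distr (Pr D) (PiM UNIV (\<lambda>_. borel)) (Z 0) \<Otimes>\<^sub>M
      (distr (Pr D) (PiM {1..m} (\<lambda>_. borel)) (Z 1) \<Otimes>\<^sub>M distr (Pr D) (PiM {1..n} (\<lambda>_. borel)) (Z 2))"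
    by (simp add: N_def)
  moreover have "Z 0 \<omega> = (\<lambda>j. Tstar D j \<omega>)" if "\<omega> \<in> space (Pr D)" for \<omega>
    using Tstar_0[OF that] by (auto simp: Z_def Y_def)
  moreover have "Z 1 = (\<lambda>\<omega>. \<lambda>j\<in>{1..m}. Useq D j \<omega>)" "Z 2 = (\<lambda>\<omega>. \<lambda>j\<in>{1..n}. Vseq D j \<omega>)"
    by (auto simp: Z_def Y_def fun_eq_iff)
  ultimately show ?thesis
    using distr_iid_uniform[OF U_uniform assms(1)] distr_iid_uniform[OF V_uniform assms(2)]
    by (simp add: driving_def cong: distr_cong)
qed

text \<open>The left-hand integrand localized to one choice of indices, point count and mode,
  written as a function of the driving sequences.\<close>

definition jump_term ::
    "('k \<times> real \<Rightarrow> real) \<Rightarrow> real \<Rightarrow> (nat \<Rightarrow> nat) \<Rightarrow> nat \<Rightarrow> nat \<Rightarrow> 'k \<Rightarrow>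
     (nat \<Rightarrow> real) \<Rightarrow> (nat \<Rightarrow> real) \<Rightarrow> (nat \<Rightarrow> real) \<Rightarrow> real" where
  "jump_term g t p n m k T U V =
     history_weight D g t p n m k T U V * of_bool (fst (indexed_path D p T V n) = k)
     * (\<Prod>q\<in>{p n + 1..m}. of_bool (accept_prob D p n k T V q < U q))"

text \<open>The intermediate form: rejection indicators averaged, mode indicator still
  present.\<close>

definition thinned_term ::
    "('k \<times> real \<Rightarrow> real) \<Rightarrow> real \<Rightarrow> (nat \<Rightarrow> nat) \<Rightarrow> nat \<Rightarrow> nat \<Rightarrow> 'k \<Rightarrow>
     (nat \<Rightarrow> real) \<Rightarrow> (nat \<Rightarrow> real) \<Rightarrow> (nat \<Rightarrow> real) \<Rightarrow> real" where
  "thinned_term g t p n m k T U V =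
     history_weight D g t p n m k T U V * of_bool (fst (indexed_path D p T V n) = k)
     * (\<Prod>q\<in>{p n + 1..m}. 1 - accept_prob D p n k T V q)"

text \<open>The right-hand integrand of the formula. With \<open>n = Suc l\<close>, the argument of
  \<open>Q_mode\<close> pairs the mode after jump \<open>l\<close> with the position at jump
  \<open>n\<close>, that is, the left limit at the \<open>n\<close>-th jump.\<close>

definition averaged_term ::
    "('k \<times> real \<Rightarrow> real) \<Rightarrow> real \<Rightarrow> (nat \<Rightarrow> nat) \<Rightarrow> nat \<Rightarrow> nat \<Rightarrow> nat \<Rightarrow> 'k \<Rightarrow>
     (nat \<Rightarrow> real) \<Rightarrow> (nat \<Rightarrow> real) \<Rightarrow> (nat \<Rightarrow> real) \<Rightarrow> real" where
  "averaged_term g t p n l m k T U V =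
     history_weight D g t p n m k T U V * Q_mode D (fst (indexed_path D p T V l), snd (indexed_path D p T V n)) k
     * (\<Prod>q\<in>{p n + 1..m}. 1 - accept_prob D p n k T V q)"

section \<open>Averaging over the uniforms for fixed indices and mode\<close>

context
  fixes g :: "'k \<times> real \<Rightarrow> real" and C t :: real and p :: "nat \<Rightarrow> nat" and n l m :: nat and k :: 'k
  assumes g[measurable]: "g \<in> borel_measurable state_space"
    and g_le: "\<And>x. \<bar>g x\<bar> \<le> C"
    and p: "strict_mono_upto n p" and p_le: "p n \<le> m" and n: "n = Suc l"
begin

lemma measurable_terms[measurable (raw)]:
  assumes [measurable]: "\<And>j. (\<lambda>x. T x j) \<in> borel_measurable N"
    "\<And>j. (\<lambda>x. U x j) \<in> borel_measurable N" "\<And>j. (\<lambda>x. V x j) \<in> borel_measurable N"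
  shows "(\<lambda>x. jump_term g t p n m k (T x) (U x) (V x)) \<in> borel_measurable N"
    and "(\<lambda>x. thinned_term g t p n m k (T x) (U x) (V x)) \<in> borel_measurable N"
    and "(\<lambda>x. averaged_term g t p n l m k (T x) (U x) (V x)) \<in> borel_measurable N"
proof -
  have [measurable]: "Measurable.pred N (\<lambda>x. fst (indexed_path D p (T x) (V x) n) = k)"
  proof -
    have "(\<lambda>x. fst (indexed_path D p (T x) (V x) n)) \<in> N \<rightarrow>\<^sub>M count_space UNIV"
      by measurable
    then show ?thesis
      by (rule measurable_compose) simp
  qed
  show "(\<lambda>x. jump_term g t p n m k (T x) (U x) (V x)) \<in> borel_measurable N"
    unfolding jump_term_def by measurable
  show "(\<lambda>x. thinned_term g t p n m k (T x) (U x) (V x)) \<in> borel_measurable N"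
    unfolding thinned_term_def by measurable
  show "(\<lambda>x. averaged_term g t p n l m k (T x) (U x) (V x)) \<in> borel_measurable N"
    unfolding averaged_term_def by measurable
qed

text \<open>Each term is the history weight times two factors in the unit interval, so one constant
  bounds all three and gives integrability over any probability law.\<close>

lemma abs_terms_le:
  "\<bar>jump_term g t p n m k T U V\<bar> \<le> C" "\<bar>thinned_term g t p n m k T U V\<bar> \<le> C" "\<bar>averaged_term g t p n l m k T U V\<bar> \<le> C"
proof -
  have h: "\<bar>history_weight D g t p n m k T U V\<bar> \<le> C"
    by (rule abs_history_weight_le) (rule g_le)
  have prod: "0 \<le> (\<Prod>q\<in>{p n + 1..m}. of_bool (accept_prob D p n k T V q < U q) :: real)"
    "(\<Prod>q\<in>{p n + 1..m}. of_bool (accept_prob D p n k T V q < U q) :: real) \<le> 1"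
    "0 \<le> (\<Prod>q\<in>{p n + 1..m}. 1 - accept_prob D p n k T V q)"
    "(\<Prod>q\<in>{p n + 1..m}. 1 - accept_prob D p n k T V q) \<le> 1"
    by (auto intro!: prod_nonneg prod_le_1 simp: accept_prob_nonneg accept_prob_le_1)
  have "0 \<le> (of_bool b :: real)" "(of_bool b :: real) \<le> 1" for b
    by simp_all
  note bounds = h prod this Q_mode_nonneg Q_mode_le_1
  show "\<bar>jump_term g t p n m k T U V\<bar> \<le> C"
    unfolding jump_term_def by (rule abs_mult_unit_le; (rule abs_mult_unit_le)?; rule bounds)
  show "\<bar>thinned_term g t p n m k T U V\<bar> \<le> C"
    unfolding thinned_term_def by (rule abs_mult_unit_le; (rule abs_mult_unit_le)?; rule bounds)
  show "\<bar>averaged_term g t p n l m k T U V\<bar> \<le> C"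
    unfolding averaged_term_def by (rule abs_mult_unit_le; (rule abs_mult_unit_le)?; rule bounds)
qed

lemma integrable_terms:
  assumes P: "prob_space P"
    and meas: "\<And>j. (\<lambda>x. T x j) \<in> borel_measurable P"
      "\<And>j. (\<lambda>x. U x j) \<in> borel_measurable P" "\<And>j. (\<lambda>x. V x j) \<in> borel_measurable P"
  shows "integrable P (\<lambda>x. jump_term g t p n m k (T x) (U x) (V x))"
    and "integrable P (\<lambda>x. thinned_term g t p n m k (T x) (U x) (V x))"
    and "integrable P (\<lambda>x. averaged_term g t p n l m k (T x) (U x) (V x))"
proof -
  interpret P: prob_space P by fact
  show "integrable P (\<lambda>x. jump_term g t p n m k (T x) (U x) (V x))"
    by (rule P.integrable_const_bound[where B = C])
      (simp add: abs_terms_le, rule measurable_terms, fact+)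
  show "integrable P (\<lambda>x. thinned_term g t p n m k (T x) (U x) (V x))"
    by (rule P.integrable_const_bound[where B = C])
      (simp add: abs_terms_le, rule measurable_terms, fact+)
  show "integrable P (\<lambda>x. averaged_term g t p n l m k (T x) (U x) (V x))"
    by (rule P.integrable_const_bound[where B = C])
      (simp add: abs_terms_le, rule measurable_terms, fact+)
qed

lemma measurable_uniform01_component: "(\<lambda>u. u j) \<in> borel_measurable (PiM I (\<lambda>_. uniform01))"
proof -
  have "sets (PiM I (\<lambda>_. uniform01)) = sets (PiM I (\<lambda>_. borel))"
    by (rule sets_PiM_cong) simp_all
  moreover have "(\<lambda>u. u j) \<in> borel_measurable (PiM I (\<lambda>_. borel))"
    by (rule measurable_PiM_component) simp
  ultimately show ?thesis
    by (simp cong: measurable_cong_sets)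
qed

text \<open>The terms read only \<open>U\<close> on \<open>{1..m}\<close> and \<open>V\<close> on
  \<open>{1..n}\<close>, so passing to the finite blocks in \<open>driving\<close> loses
  nothing.\<close>

lemma terms_restrict:
  "jump_term g t p n m k T (restrict U {1..m}) (restrict V {1..n}) = jump_term g t p n m k T U V"
  "averaged_term g t p n l m k T (restrict U {1..m}) (restrict V {1..n}) = averaged_term g t p n l m k T U V"
proof -
  let ?U = "restrict U {1..m}" and ?V = "restrict V {1..n}"
  have h: "history_weight D g t p n m k T ?U ?V = history_weight D g t p n m k T U V"
    using p p_le by (intro history_weight_cong) auto
  have a: "accept_prob D p n k T ?V q = accept_prob D p n k T V q" for q
    by (rule accept_prob_cong) auto
  have path: "indexed_path D p T ?V n = indexed_path D p T V n" "indexed_path D p T ?V l = indexed_path D p T V l"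
    by (rule indexed_path_cong; use n in simp)+
  have "(\<Prod>q\<in>{p n + 1..m}. of_bool (accept_prob D p n k T V q < ?U q) :: real)
      = (\<Prod>q\<in>{p n + 1..m}. of_bool (accept_prob D p n k T V q < U q))"
    by (rule prod.cong) auto
  then show "jump_term g t p n m k T ?U ?V = jump_term g t p n m k T U V" "averaged_term g t p n l m k T ?U ?V = averaged_term g t p n l m k T U V"
    by (simp_all only: jump_term_def averaged_term_def h a path)
qed

text \<open>With \<open>T\<close> and \<open>V\<close> frozen, the history weight reads
  \<open>U\<close> only up to \<open>p n\<close>, and the rejection thresholds do not read
  \<open>U\<close> at all. Each later uniform exceeds its threshold with probability one minus that
  threshold.\<close>

lemma integral_thinning:
  "(\<integral>u. jump_term g t p n m k T u V \<partial>PiM {1..m} (\<lambda>_. uniform01)) = (\<integral>u. thinned_term g t p n m k T u V \<partial>PiM {1..m} (\<lambda>_. uniform01))"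
proof -
  interpret U: prob_space uniform01
    by (rule prob_space_uniform01)
  interpret product_prob_space "\<lambda>_::nat. uniform01"
    by unfold_locales
  let ?J = "{1..p n}" and ?K = "{p n + 1..m}"
  let ?P = "PiM {1..m} (\<lambda>_. uniform01)"
  have P: "prob_space ?P"
    by (intro prob_space_PiM U.prob_space_axioms)
  have JK: "?J \<union> ?K = {1..m}"
    using p_le by auto
  let ?A = "\<lambda>u. history_weight D g t p n m k T u V * of_bool (fst (indexed_path D p T V n) = k)"
  have avg: "(\<integral>y. of_bool (accept_prob D p n k T V q < y) \<partial>uniform01) = 1 - accept_prob D p n k T V q" for q
    by (intro integral_uniform01_of_bool_less accept_prob_nonneg accept_prob_le_1)
  have "(\<integral>u. ?A u * (\<Prod>q\<in>?K. of_bool (accept_prob D p n k T V q < u q)) \<partial>PiM (?J \<union> ?K) (\<lambda>_. uniform01))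
      = (\<integral>u. ?A u * (\<Prod>q\<in>?K. \<integral>y. of_bool (accept_prob D p n k T V q < y) \<partial>uniform01) \<partial>PiM (?J \<union> ?K) (\<lambda>_. uniform01))"
  proof (rule integral_PiM_prod)
    show "?A u = ?A v" if "\<And>j. j \<in> ?J \<Longrightarrow> u j = v j" for u v
      using that by (subst history_weight_cong[OF p, of V V u v]) auto
    show "integrable uniform01 (\<lambda>y. of_bool (accept_prob D p n k T V q < y) :: real)" for q
      by (rule U.integrable_const_bound[where B = 1]) auto
    show "integrable (PiM (?J \<union> ?K) (\<lambda>_. uniform01))
        (\<lambda>u. ?A u * (\<Prod>q\<in>?K. of_bool (accept_prob D p n k T V q < u q)))"
      unfolding JK jump_term_def[symmetric]
      by (intro integrable_terms P measurable_uniform01_component) simp_all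
    show "integrable (PiM (?J \<union> ?K) (\<lambda>_. uniform01))
        (\<lambda>u. ?A u * (\<Prod>q\<in>?K. \<integral>y. of_bool (accept_prob D p n k T V q < y) \<partial>uniform01))"
      unfolding JK avg thinned_term_def[symmetric]
      by (intro integrable_terms P measurable_uniform01_component) simp_all
  qed auto
  then show ?thesis
    unfolding JK avg by (simp add: jump_term_def thinned_term_def)
qed

text \<open>With \<open>T\<close> and \<open>U\<close> frozen, \<open>V n\<close> enters only
  through the last mode choice; averaging that single coordinate replaces the mode indicator by the
  kernel probability.\<close>

lemma integral_mode:
  "(\<integral>v. thinned_term g t p n m k T U v \<partial>PiM {1..n} (\<lambda>_. uniform01)) = (\<integral>v. averaged_term g t p n l m k T U v \<partial>PiM {1..n} (\<lambda>_. uniform01))"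
proof -
  interpret U: prob_space uniform01
    by (rule prob_space_uniform01)
  interpret product_prob_space "\<lambda>_::nat. uniform01"
    by unfold_locales
  let ?P = "PiM {1..n} (\<lambda>_. uniform01)"
  have P: "prob_space ?P"
    by (intro prob_space_PiM U.prob_space_axioms)
  have JK: "{1..l} \<union> {n} = {1..n}"
    using n by auto
  let ?A = "\<lambda>v. history_weight D g t p n m k T U v * (\<Prod>q\<in>{p n + 1..m}. 1 - accept_prob D p n k T v q)"
  let ?x = "\<lambda>v. (fst (indexed_path D p T v l), snd (indexed_path D p T v n))"
  let ?h = "\<lambda>v y. of_bool (H_mode D (?x v) y = k) :: real"
  \<comment> \<open>Unfolding the last recursion step exposes \<open>V n\<close> as the argument of
    \<open>H_mode\<close>, whose other argument depends on earlier coordinates only.\<close>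
  have fst_path: "fst (indexed_path D p T v n) = H_mode D (?x v) (v n)" for v
    by (simp add: n Let_def)
  have thinned: "thinned_term g t p n m k T U v = ?A v * (\<Prod>q\<in>{n}. ?h v (v q))" for v
    by (simp add: thinned_term_def fst_path)
  have averaged: "averaged_term g t p n l m k T U v = ?A v * (\<Prod>q\<in>{n}. \<integral>y. ?h v y \<partial>uniform01)" for v
    by (simp add: averaged_term_def integral_H_mode)
  have "(\<integral>v. ?A v * (\<Prod>q\<in>{n}. ?h v (v q)) \<partial>PiM ({1..l} \<union> {n}) (\<lambda>_. uniform01))
      = (\<integral>v. ?A v * (\<Prod>q\<in>{n}. \<integral>y. ?h v y \<partial>uniform01) \<partial>PiM ({1..l} \<union> {n}) (\<lambda>_. uniform01))"
  proof (rule integral_PiM_prod)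
    fix u v assume *: "\<And>j. j \<in> {1..l} \<Longrightarrow> u j = (v j :: real)"
    have "history_weight D g t p n m k T U u = history_weight D g t p n m k T U v"
      using * n by (intro history_weight_cong[OF p]) auto
    moreover have "accept_prob D p n k T u q = accept_prob D p n k T v q" for q
      using * n by (intro accept_prob_cong) auto
    ultimately show "?A u = ?A v" by simp
    have "indexed_path D p T u l = indexed_path D p T v l"
      using * by (intro indexed_path_cong) auto
    moreover have "snd (indexed_path D p T u n) = snd (indexed_path D p T v n)"
      using * n by (intro snd_indexed_path_cong) auto
    ultimately show "?h u y = ?h v y" for y by simp
  next
    fix v
    have "(\<lambda>u. H_mode D (?x v) u) \<in> borel \<rightarrow>\<^sub>M count_space UNIV"
      by (intro measurable_H_mode) (simp_all add: space_pair_measure)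
    then have [measurable]: "Measurable.pred borel (\<lambda>u. H_mode D (?x v) u = k)"
      by (rule measurable_compose) simp
    show "integrable uniform01 (?h v)"
      by (rule U.integrable_const_bound[where B = 1]) simp_all
  next
    show "integrable (PiM ({1..l} \<union> {n}) (\<lambda>_. uniform01)) (\<lambda>v. ?A v * (\<Prod>q\<in>{n}. ?h v (v q)))"
      unfolding JK thinned[symmetric]
      by (intro integrable_terms P measurable_uniform01_component) simp_all
    show "integrable (PiM ({1..l} \<union> {n}) (\<lambda>_. uniform01)) (\<lambda>v. ?A v * (\<Prod>q\<in>{n}. \<integral>y. ?h v y \<partial>uniform01))"
      unfolding JK averaged[symmetric]
      by (intro integrable_terms P measurable_uniform01_component) simp_all
  qed (use n in auto)
  then show ?thesis
    unfolding JK thinned averaged .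
qed

text \<open>Fubini in both orders: \<open>U\<close> is averaged inside for fixed \<open>V\<close>,
  then \<open>V\<close> inside for fixed \<open>U\<close>.\<close>

lemma integral_pair_terms:
  assumes "1 \<le> m"
  shows "(\<integral>(U, V). jump_term g t p n m k T U V \<partial>(PiM {1..m} (\<lambda>_. uniform01) \<Otimes>\<^sub>M PiM {1..n} (\<lambda>_. uniform01)))
       = (\<integral>(U, V). averaged_term g t p n l m k T U V \<partial>(PiM {1..m} (\<lambda>_. uniform01) \<Otimes>\<^sub>M PiM {1..n} (\<lambda>_. uniform01)))"
proof -
  let ?PU = "PiM {1..m} (\<lambda>_. uniform01)" and ?PV = "PiM {1..n} (\<lambda>_. uniform01)"
  interpret PU: prob_space ?PU
    by (intro prob_space_PiM prob_space_uniform01)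
  interpret PV: prob_space ?PV
    by (intro prob_space_PiM prob_space_uniform01)
  interpret PUV: pair_prob_space ?PU ?PV ..
  have U: "(\<lambda>z. fst z j) \<in> borel_measurable (?PU \<Otimes>\<^sub>M ?PV)"
    and V: "(\<lambda>z. snd z j) \<in> borel_measurable (?PU \<Otimes>\<^sub>M ?PV)" for j
    by (rule measurable_compose[OF measurable_fst measurable_uniform01_component]
        measurable_compose[OF measurable_snd measurable_uniform01_component])+
  have int: "integrable (?PU \<Otimes>\<^sub>M ?PV) (\<lambda>(U, V). jump_term g t p n m k T U V)"
    "integrable (?PU \<Otimes>\<^sub>M ?PV) (\<lambda>(U, V). thinned_term g t p n m k T U V)"
    "integrable (?PU \<Otimes>\<^sub>M ?PV) (\<lambda>(U, V). averaged_term g t p n l m k T U V)"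
    unfolding case_prod_beta by (rule integrable_terms[OF PUV.prob_space_axioms _ U V]; simp)+
  have "(\<integral>(U, V). jump_term g t p n m k T U V \<partial>(?PU \<Otimes>\<^sub>M ?PV)) = (\<integral>V. (\<integral>U. jump_term g t p n m k T U V \<partial>?PU) \<partial>?PV)"
    by (rule PUV.integral_snd[symmetric]) (rule int)
  also have "\<dots> = (\<integral>V. (\<integral>U. thinned_term g t p n m k T U V \<partial>?PU) \<partial>?PV)"
    by (simp only: integral_thinning)
  also have "\<dots> = (\<integral>(U, V). thinned_term g t p n m k T U V \<partial>(?PU \<Otimes>\<^sub>M ?PV))"
    by (rule PUV.integral_snd) (rule int)
  also have "\<dots> = (\<integral>U. (\<integral>V. thinned_term g t p n m k T U V \<partial>?PV) \<partial>?PU)"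
    by (rule PUV.integral_fst[symmetric]) (rule int)
  also have "\<dots> = (\<integral>U. (\<integral>V. averaged_term g t p n l m k T U V \<partial>?PV) \<partial>?PU)"
    by (simp only: integral_mode)
  also have "\<dots> = (\<integral>(U, V). averaged_term g t p n l m k T U V \<partial>(?PU \<Otimes>\<^sub>M ?PV))"
    by (rule PUV.integral_fst) (rule int)
  finally show ?thesis .
qed

text \<open>Both integrands factor through \<open>driving\<close>. In its law the Poisson times are
  independent of the uniforms, so they may be frozen while the uniforms are averaged.\<close>

lemma measurable_jump_term:
  "(\<lambda>\<omega>. jump_term g t p n m k (\<lambda>j. Tstar D j \<omega>) (\<lambda>j. Useq D j \<omega>) (\<lambda>j. Vseq D j \<omega>)) \<in> borel_measurable (Pr D)"
  and integral_jump_term: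
  "(\<integral>\<omega>. jump_term g t p n m k (\<lambda>j. Tstar D j \<omega>) (\<lambda>j. Useq D j \<omega>) (\<lambda>j. Vseq D j \<omega>) \<partial>Pr D)
   = (\<integral>\<omega>. averaged_term g t p n l m k (\<lambda>j. Tstar D j \<omega>) (\<lambda>j. Useq D j \<omega>) (\<lambda>j. Vseq D j \<omega>) \<partial>Pr D)"
proof -
  let ?F = "\<lambda>(T, U, V). jump_term g t p n m k T U V" and ?G = "\<lambda>(T, U, V). averaged_term g t p n l m k T U V"
  have F: "jump_term g t p n m k (\<lambda>j. Tstar D j \<omega>) (\<lambda>j. Useq D j \<omega>) (\<lambda>j. Vseq D j \<omega>) = ?F (driving m n \<omega>)" for \<omega>
    unfolding driving_def prod.case terms_restrict ..
  have G: "averaged_term g t p n l m k (\<lambda>j. Tstar D j \<omega>) (\<lambda>j. Useq D j \<omega>) (\<lambda>j. Vseq D j \<omega>) = ?G (driving m n \<omega>)" for \<omega>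
    unfolding driving_def prod.case terms_restrict ..
  have coord: "(\<lambda>z. fst z j) \<in> borel_measurable (driving_space m n)"
    "(\<lambda>z. fst (snd z) j) \<in> borel_measurable (driving_space m n)"
    "(\<lambda>z. snd (snd z) j) \<in> borel_measurable (driving_space m n)" for j
    by (rule measurable_compose[OF measurable_fst measurable_PiM_component]
        measurable_compose[OF measurable_compose[OF measurable_snd measurable_fst] measurable_PiM_component]
        measurable_compose[OF measurable_compose[OF measurable_snd measurable_snd] measurable_PiM_component]; simp)+
  have FG_meas: "?F \<in> borel_measurable (driving_space m n)" "?G \<in> borel_measurable (driving_space m n)"
    unfolding case_prod_beta by (rule measurable_terms coord)+
  show "(\<lambda>\<omega>. jump_term g t p n m k (\<lambda>j. Tstar D j \<omega>) (\<lambda>j. Useq D j \<omega>) (\<lambda>j. Vseq D j \<omega>)) \<in> borel_measurable (Pr D)"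
    unfolding F using FG_meas(1) by (rule measurable_compose[OF measurable_driving])
  \<comment> \<open>Hence \<open>m\<close> is at least 1, as the law of the uniform block
    demands.\<close>
  have "n \<le> p n"
    using p by (rule strict_mono_upto_ge) simp
  with n p_le have mn: "1 \<le> m" "1 \<le> n"
    by auto
  let ?\<mu> = "distr (Pr D) (PiM UNIV (\<lambda>_. borel)) (\<lambda>\<omega> j. Tstar D j \<omega>)"
  let ?P = "PiM {1..m} (\<lambda>_. uniform01) \<Otimes>\<^sub>M PiM {1..n} (\<lambda>_. uniform01)"
  have law: "distr (Pr D) (driving_space m n) (driving m n) = ?\<mu> \<Otimes>\<^sub>M ?P"
    using mn by (rule distr_driving)
  have "(\<lambda>\<omega>. fst (driving m n \<omega>)) \<in> Pr D \<rightarrow>\<^sub>M PiM UNIV (\<lambda>_. borel)"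
    using measurable_driving measurable_fst by (rule measurable_compose)
  then have "(\<lambda>\<omega> j. Tstar D j \<omega>) \<in> Pr D \<rightarrow>\<^sub>M PiM UNIV (\<lambda>_. borel)"
    by (simp add: driving_def)
  then interpret \<mu>: prob_space ?\<mu>
    by (rule prob_space_distr)
  interpret PU: prob_space "PiM {1..m} (\<lambda>_. uniform01)"
    by (intro prob_space_PiM prob_space_uniform01)
  interpret PV: prob_space "PiM {1..n} (\<lambda>_. uniform01)"
    by (intro prob_space_PiM prob_space_uniform01)
  interpret PUV: pair_prob_space "PiM {1..m} (\<lambda>_. uniform01)" "PiM {1..n} (\<lambda>_. uniform01)" ..
  interpret L: pair_prob_space ?\<mu> ?P ..
  have int: "integrable (?\<mu> \<Otimes>\<^sub>M ?P) ?F" "integrable (?\<mu> \<Otimes>\<^sub>M ?P) ?G"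
    unfolding law[symmetric] case_prod_beta
    by (rule integrable_terms[OF prob_space_distr[OF measurable_driving]]; simp only: measurable_distr_eq1; rule coord)+
  have "(\<integral>\<omega>. ?F (driving m n \<omega>) \<partial>Pr D) = (\<integral>z. ?F z \<partial>(?\<mu> \<Otimes>\<^sub>M ?P))"
    unfolding law[symmetric] by (rule integral_distr[OF measurable_driving FG_meas(1), symmetric])
  also have "\<dots> = (\<integral>T. (\<integral>z. ?F (T, z) \<partial>?P) \<partial>?\<mu>)"
    by (rule L.integral_fst'[symmetric]) (rule int)
  also have "\<dots> = (\<integral>T. (\<integral>z. ?G (T, z) \<partial>?P) \<partial>?\<mu>)"
    using integral_pair_terms[OF mn(1)] by simp
  also have "\<dots> = (\<integral>z. ?G z \<partial>(?\<mu> \<Otimes>\<^sub>M ?P))"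
    by (rule L.integral_fst') (rule int)
  also have "\<dots> = (\<integral>\<omega>. ?G (driving m n \<omega>) \<partial>Pr D)"
    unfolding law[symmetric] by (rule integral_distr[OF measurable_driving FG_meas(2)])
  finally show "(\<integral>\<omega>. jump_term g t p n m k (\<lambda>j. Tstar D j \<omega>) (\<lambda>j. Useq D j \<omega>) (\<lambda>j. Vseq D j \<omega>) \<partial>Pr D)
      = (\<integral>\<omega>. averaged_term g t p n l m k (\<lambda>j. Tstar D j \<omega>) (\<lambda>j. Useq D j \<omega>) (\<lambda>j. Vseq D j \<omega>) \<partial>Pr D)"
    unfolding F G .
qed

end

section \<open>Identification of the terms with the process\<close>

lemma before_next_jump_iff:
  assumes \<omega>: "\<omega> \<in> space (Pr D)" and t: "0 \<le> t" and a: "\<tau> D n \<omega> = enat a" and m: "Nstar D t \<omega> = m"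
  shows "ereal t < jump_time D (Suc n) \<omega> \<longleftrightarrow>
    (\<forall>q\<in>{a + 1..m}. intensity D (\<theta> D n \<omega>, \<nu> D n \<omega>) (Tstar D q \<omega> - Tstar D a \<omega>) < Useq D q \<omega> * rate_bound D)"
    (is "?L \<longleftrightarrow> (\<forall>q\<in>_. ?R q)")
proof
  assume L: ?L
  show "\<forall>q\<in>{a + 1..m}. ?R q"
  proof (rule ccontr)
    assume "\<not> (\<forall>q\<in>{a + 1..m}. ?R q)"
    then have ex: "\<exists>q. a < q \<and> q \<le> m \<and> \<not> ?R q"
      by (auto simp: Suc_le_eq)
    \<comment> \<open>The first accepted candidate after \<open>a\<close> would be the next jump
      index, and as \<open>b\<close> is at most \<open>m\<close> that jump would occur by time
      \<open>t\<close>.\<close>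
    define b where "b = (LEAST q. a < q \<and> q \<le> m \<and> \<not> ?R q)"
    have b: "a < b" "b \<le> m" "\<not> ?R b"
      unfolding b_def using LeastI_ex[OF ex] by blast+
    have "?R q" if "a < q" "q < b" for q
      using not_less_Least[of q "\<lambda>q. a < q \<and> q \<le> m \<and> \<not> ?R q"] that b(2) unfolding b_def[symmetric] by auto
    with b have "\<tau> D (Suc n) \<omega> = enat b"
      by (simp add: tau_Suc_iff_intensity[OF \<omega> a] del: \<tau>.simps)
    then have "jump_time D (Suc n) \<omega> = ereal (Tstar D b \<omega>)"
      by (simp add: jump_time_def del: \<tau>.simps)
    moreover have "Tstar D b \<omega> \<le> t"
      using b(2) m by (simp add: Tstar_le_iff_Nstar[OF \<omega> t])
    ultimately show False
      using L by simp
  qed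
next
  assume R: "\<forall>q\<in>{a + 1..m}. ?R q"
  show ?L
  proof (cases "\<tau> D (Suc n) \<omega>")
    case (enat b)
    then have "a < b"
      by (simp only: tau_Suc_eq_iff a enat_ord_simps)
    then have "\<not> ?R b"
      using enat by (simp add: tau_Suc_iff_intensity[OF \<omega> a] not_less del: \<tau>.simps)
    with R \<open>a < b\<close> have "\<not> b \<le> m"
      by auto
    then have "t < Tstar D b \<omega>"
      using Tstar_le_iff_Nstar[OF \<omega> t, of b] m by auto
    with enat show ?thesis
      by (simp add: jump_time_def del: \<tau>.simps)
  qed (simp add: jump_time_def del: \<tau>.simps)
qed

lemma prod_of_bool: "finite A \<Longrightarrow> (\<Prod>q\<in>A. of_bool (P q) :: real) = of_bool (\<forall>q\<in>A. P q)"
  by (induction A rule: finite_induct) auto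

text \<open>On the event that the last mode is \<open>k\<close>, the thresholds computed with
  \<open>k\<close> are the true ones, so the rejections say exactly that no further jump occurs by
  \<open>t\<close>.\<close>

lemma jump_term_eq:
  assumes \<omega>: "\<omega> \<in> space (Pr D)" and t: "0 \<le> t"
    and p: "strict_mono_upto n p" "p n \<le> m" and n: "1 \<le> n"
  shows "jump_term g t p n m k (\<lambda>j. Tstar D j \<omega>) (\<lambda>j. Useq D j \<omega>) (\<lambda>j. Vseq D j \<omega>) =
    g (pdp D t \<omega>) * of_bool (jump_count D t \<omega> = n \<and> (\<forall>i\<le>n. \<tau> D i \<omega> = enat (p i)) \<and> Nstar D t \<omega> = m \<and> \<theta> D n \<omega> = k)"
proof -
  let ?T = "\<lambda>j. Tstar D j \<omega>" and ?U = "\<lambda>j. Useq D j \<omega>" and ?V = "\<lambda>j. Vseq D j \<omega>"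
  have hist: "(\<forall>i<n. accepted D p ?T ?U ?V i) \<longleftrightarrow> (\<forall>i\<le>n. \<tau> D i \<omega> = enat (p i))"
    using p(1) by (intro tau_eq_iff_accepted[OF \<omega>, symmetric]) (auto simp: strict_mono_upto_def)
  show ?thesis
  proof (cases "(\<forall>i\<le>n. \<tau> D i \<omega> = enat (p i)) \<and> Nstar D t \<omega> = m \<and> \<theta> D n \<omega> = k")
    case False
    \<comment> \<open>The path gives the true mode only on the event of prescribed indices; off that
      event the history weight already vanishes.\<close>
    have "fst (indexed_path D p ?T ?V n) = \<theta> D n \<omega>" if "\<forall>i\<le>n. \<tau> D i \<omega> = enat (p i)"
      using that p(1) by (subst indexed_path_eq[OF \<omega>]) (auto simp: strict_mono_upto_def)
    with False show ?thesis
      by (auto simp: jump_term_def history_weight_def hist Nstar_eq_iff[OF \<omega> t])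
  next
    case True
    then have tau: "\<tau> D n \<omega> = enat (p n)" and N: "Nstar D t \<omega> = m" and k: "\<theta> D n \<omega> = k"
      by auto
    have path: "indexed_path D p ?T ?V n = (k, \<nu> D n \<omega>)"
      using True p(1) by (subst indexed_path_eq[OF \<omega>]) (auto simp: strict_mono_upto_def)
    have jt: "jump_time D n \<omega> = ereal (Tstar D (p n) \<omega>)"
      using tau by (simp add: jump_time_def)
    have T_le: "Tstar D (p n) \<omega> \<le> t"
      using p(2) N by (simp add: Tstar_le_iff_Nstar[OF \<omega> t])
    \<comment> \<open>Since \<open>p n\<close> is positive, the last jump has positive time, so
      \<open>t\<close> is positive and the special value of \<open>pdp\<close> at 0 does not
      intervene.\<close>
    have "n \<le> p n"
      using p(1) by (rule strict_mono_upto_ge) simp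
    then have "0 < p n"
      using n by simp
    then have "0 < Tstar D (p n) \<omega>"
      using Tstar_less[OF \<omega>, of 0 "p n"] Tstar_0[OF \<omega>] by simp
    with T_le have "0 < t"
      by simp
    have count: "jump_count D t \<omega> = n \<longleftrightarrow> (\<forall>q\<in>{p n + 1..m}. accept_prob D p n k ?T ?V q < ?U q)"
      unfolding jump_count_eq_iff[OF \<omega> t] before_next_jump_iff[OF \<omega> t tau N] k
      using T_le rate_bound_pos by (simp add: jt accept_prob_def path pos_divide_less_eq)
    have "jump_term g t p n m k ?T ?U ?V =
        g (k, flow_at D (k, \<nu> D n \<omega>) (t - Tstar D (p n) \<omega>)) * of_bool (jump_count D t \<omega> = n)"
      using True Nstar_eq_iff[OF \<omega> t, of m]
      by (simp add: jump_term_def history_weight_def hist path count prod_of_bool)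
    also have "\<dots> = g (pdp D t \<omega>) * of_bool (jump_count D t \<omega> = n)"
      using pdp_eq[OF \<omega> \<open>0 < t\<close>, of n] T_le by (auto simp: k jt flow_at_eq)
    finally show ?thesis
      using True by simp
  qed
qed

text \<open>Here \<open>k\<close> is a free parameter, not tied to the actual mode after the jump.
  Off the event both sides vanish; on it the elapsed times are nonnegative and every truncation
  disappears.\<close>

lemma averaged_term_eq:
  assumes \<omega>: "\<omega> \<in> space (Pr D)" and t: "0 \<le> t"
    and p: "strict_mono_upto n p" "p n \<le> m" and n: "n = Suc l"
  shows "averaged_term g t p n l m k (\<lambda>j. Tstar D j \<omega>) (\<lambda>j. Useq D j \<omega>) (\<lambda>j. Vseq D j \<omega>) =
    Q_mode D (pdp_minus D (Tstar D (p n) \<omega>) \<omega>) k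
    * g (k, \<Phi> D k (t - Tstar D (p n) \<omega>) (\<nu> D n \<omega>))
    * of_bool ((\<forall>i\<in>{1..n}. \<tau> D i \<omega> = enat (p i)) \<and> Nstar D t \<omega> = m)
    * (\<Prod>q = p n + 1..m. 1 - rate D (k, \<Phi> D k (Tstar D q \<omega> - Tstar D (p n) \<omega>) (\<nu> D n \<omega>)) / rate_bound D)"
proof -
  let ?T = "\<lambda>j. Tstar D j \<omega>" and ?U = "\<lambda>j. Useq D j \<omega>" and ?V = "\<lambda>j. Vseq D j \<omega>"
  have hist: "(\<forall>i<n. accepted D p ?T ?U ?V i) \<longleftrightarrow> (\<forall>i\<le>n. \<tau> D i \<omega> = enat (p i))"
    using p(1) by (intro tau_eq_iff_accepted[OF \<omega>, symmetric]) (auto simp: strict_mono_upto_def)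
  also have "\<dots> \<longleftrightarrow> (\<forall>i\<in>{1..n}. \<tau> D i \<omega> = enat (p i))" (is "_ \<longleftrightarrow> ?E")
    using p(1) by (force simp: strict_mono_upto_def zero_enat_def Suc_le_eq simp del: \<tau>.simps(2))
  finally have hist': "(\<forall>i<n. accepted D p ?T ?U ?V i) \<longleftrightarrow> ?E" .
  show ?thesis
  proof (cases "?E \<and> Nstar D t \<omega> = m")
    case False
    then have "\<not> ((\<forall>i<n. accepted D p ?T ?U ?V i) \<and> ?T m \<le> t \<and> t < ?T (Suc m))"
      unfolding hist' Nstar_eq_iff[OF \<omega> t] .
    with False show ?thesis
      by (simp only: averaged_term_def history_weight_def of_bool_eq mult_zero_left mult_zero_right)
  next
    case True
    then have E: "\<tau> D i \<omega> = enat (p i)" if "i \<le> n" for i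
      using that hist hist' by blast
    have path: "indexed_path D p ?T ?V i = (\<theta> D i \<omega>, \<nu> D i \<omega>)" if "i \<le> n" for i
      using that p(1) E by (intro indexed_path_eq[OF \<omega>]) (auto simp: strict_mono_upto_def)
    have T_le: "Tstar D (p n) \<omega> \<le> t"
      using p(2) True by (simp add: Tstar_le_iff_Nstar[OF \<omega> t])
    have minus: "pdp_minus D (Tstar D (p n) \<omega>) \<omega> = (\<theta> D l \<omega>, \<nu> D n \<omega>)"
      using pdp_minus_eq[OF \<omega>, of n "p n"] E[of n] n by simp
    have "accept_prob D p n k ?T ?V q
        = rate D (k, \<Phi> D k (Tstar D q \<omega> - Tstar D (p n) \<omega>) (\<nu> D n \<omega>)) / rate_bound D"
      if "q \<in> {p n + 1..m}" for q
      using that Tstar_le[OF \<omega>, of "p n" q] path[of n]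
      by (simp add: accept_prob_def intensity_def flow_at_eq)
    then have "(\<Prod>q = p n + 1..m. 1 - accept_prob D p n k ?T ?V q) =
      (\<Prod>q = p n + 1..m. 1 - rate D (k, \<Phi> D k (Tstar D q \<omega> - Tstar D (p n) \<omega>) (\<nu> D n \<omega>)) / rate_bound D)"
      by (intro prod.cong) auto
    moreover have "history_weight D g t p n m k ?T ?U ?V = g (k, \<Phi> D k (t - Tstar D (p n) \<omega>) (\<nu> D n \<omega>))"
      using True T_le path[of n] unfolding history_weight_def hist' Nstar_eq_iff[OF \<omega> t]
      by (simp add: flow_at_eq)
    moreover have "indexed_path D p ?T ?V n = (\<theta> D n \<omega>, \<nu> D n \<omega>)" "indexed_path D p ?T ?V l = (\<theta> D l \<omega>, \<nu> D l \<omega>)"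
      by (rule path; use n in simp)+
    moreover have "of_bool (?E \<and> Nstar D t \<omega> = m) = (1 :: real)"
      unfolding of_bool_eq_1_iff by (rule True)
    ultimately show ?thesis
      by (simp only: averaged_term_def minus fst_conv snd_conv mult_1_right mult.commute)
  qed
qed

end

section \<open>Summation over the jump indices\<close>

text \<open>The summation index lives on \<open>{1..n}\<close> and is undefined at 0; the added
  value encodes the zeroth index, and the first step is strict because all values are at least
  1.\<close>

lemma strict_mono_upto_extend:
  assumes "p \<in> {1..n} \<rightarrow>\<^sub>E {1..m}" "strict_mono_on {1..n} p"
  shows "strict_mono_upto n (p(0 := 0))"
  unfolding strict_mono_upto_def
proof (intro conjI allI impI)
  fix i assume "i < n"
  show "(p(0 := 0)) i < (p(0 := 0)) (Suc i)"
  proof (cases i)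
    case 0
    have "p (Suc i) \<in> {1..m}"
      using assms(1) by (rule PiE_mem) (use \<open>i < n\<close> in simp)
    with 0 show ?thesis by simp
  next
    case (Suc l)
    then show ?thesis
      using strict_mono_onD[OF assms(2), of i "Suc i"] \<open>i < n\<close> by simp
  qed
qed simp

context pdp_thinning
begin

text \<open>On \<open>n\<close> jumps by time \<open>t\<close> the actual jump indices form one of
  the admissible tuples. The restriction to \<open>{1..n}\<close> makes the tuple extensional, hence
  a member of the index set.\<close>

lemma jump_indices:
  assumes \<omega>: "\<omega> \<in> space (Pr D)" and t: "0 \<le> t" and count: "jump_count D t \<omega> = n"
  defines "p \<equiv> \<lambda>i\<in>{1..n}. the_enat (\<tau> D i \<omega>)"
  shows "\<And>i. i \<in> {1..n} \<Longrightarrow> \<tau> D i \<omega> = enat (p i)"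
    and "p \<in> {1..n} \<rightarrow>\<^sub>E {1..Nstar D t \<omega>}"
    and "strict_mono_on {1..n} p"
proof -
  have le: "jump_time D i \<omega> \<le> ereal t" if "i \<le> n" for i
    using jump_time_mono[OF \<omega> that] count unfolding jump_count_eq_iff[OF \<omega> t] by (blast intro: order_trans)
  show tau: "\<tau> D i \<omega> = enat (p i)" if "i \<in> {1..n}" for i
  proof -
    have "jump_time D i \<omega> \<noteq> \<infinity>"
      using le[of i] that by auto
    then obtain j where "\<tau> D i \<omega> = enat j"
      by (cases "\<tau> D i \<omega>") (simp_all add: jump_time_def)
    with that show ?thesis
      by (simp add: p_def)
  qed
  have jt: "jump_time D i \<omega> = ereal (Tstar D (p i) \<omega>)" if "i \<in> {1..n}" for i
    using tau[OF that] by (simp add: jump_time_def)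
  show "p \<in> {1..n} \<rightarrow>\<^sub>E {1..Nstar D t \<omega>}"
  proof (rule PiE_I)
    fix i assume i: "i \<in> {1..n}"
    have "p i \<le> Nstar D t \<omega>"
      using le[of i] jt[OF i] i Tstar_le_iff_Nstar[OF \<omega> t] by simp
    moreover have "jump_time D 0 \<omega> < jump_time D i \<omega>"
      using i by (intro jump_time_strict[OF \<omega>]) (auto simp: jump_time_0[OF \<omega>])
    then have "Tstar D 0 \<omega> < Tstar D (p i) \<omega>"
      using jt[OF i] by (simp add: jump_time_0[OF \<omega>] Tstar_0[OF \<omega>])
    then have "0 < p i"
      by (simp only: Tstar_less[OF \<omega>])
    ultimately show "p i \<in> {1..Nstar D t \<omega>}" by simp
  qed (auto simp: p_def)
  show "strict_mono_on {1..n} p"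
  proof (rule strict_mono_onI)
    fix i j assume ij: "i \<in> {1..n}" "j \<in> {1..n}" "i < j"
    then have "jump_time D i \<omega> < jump_time D j \<omega>"
      by (intro jump_time_strict[OF \<omega>]) (auto simp: jt)
    with jt ij show "p i < p j"
      by (simp add: Tstar_less[OF \<omega>])
  qed
qed

text \<open>For each outcome at most one triple of indices, point count and mode contributes, so the
  absolute partial sums are bounded by \<open>C\<close> and termwise integration applies.\<close>

lemma has_sum_jump_term:
  assumes g: "g \<in> borel_measurable state_space" and g_le: "\<And>x. \<bar>g x\<bar> \<le> C"
    and t: "0 \<le> t" and n: "1 \<le> n"
  defines "S \<equiv> {(p, m). p \<in> {1..n} \<rightarrow>\<^sub>E {1..m} \<and> strict_mono_on {1..n} p}"
  defines "F \<equiv> \<lambda>((p, m), k) \<omega>.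
      jump_term g t (p(0 := 0)) n m k (\<lambda>j. Tstar D j \<omega>) (\<lambda>j. Useq D j \<omega>) (\<lambda>j. Vseq D j \<omega>)"
  shows "((\<lambda>j. \<integral>\<omega>. F j \<omega> \<partial>Pr D) has_sum
      (\<integral>\<omega>. g (pdp D t \<omega>) * of_bool (jump_count D t \<omega> = n) \<partial>Pr D)) (S \<times> UNIV)"
proof (rule has_sum_integral[where C = C])
  have S: "strict_mono_upto n (p(0 := 0))" "(p(0 := 0)) n \<le> m" if "(p, m) \<in> S" for p m
  proof -
    have *: "p \<in> {1..n} \<rightarrow>\<^sub>E {1..m}" "strict_mono_on {1..n} p"
      using that by (auto simp: S_def)
    then show "strict_mono_upto n (p(0 := 0))"
      by (rule strict_mono_upto_extend)
    have "p n \<in> {1..m}"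
      using *(1) by (rule PiE_mem) (use n in simp)
    with n show "(p(0 := 0)) n \<le> m" by simp
  qed
  have "S \<subseteq> ({1..n} \<rightarrow>\<^sub>E UNIV) \<times> UNIV"
    by (auto simp: S_def PiE_def)
  then have "countable S"
    by (rule countable_subset) (intro countable_SIGMA countable_PiE; simp)
  then show "countable (S \<times> (UNIV :: 'k set))"
    by (rule countable_SIGMA) (rule countable_modes)
  show "F j \<in> borel_measurable (Pr D)" if "j \<in> S \<times> UNIV" for j
  proof -
    obtain p m k where j: "j = ((p, m), k)"
      by (metis surj_pair)
    then have "(p, m) \<in> S"
      using that by simp
    then show ?thesis
      unfolding j F_def prod.case using n
      by (intro measurable_jump_term[OF g g_le, of n "p(0 := 0)" m "n - 1"] S) auto
  qed
  have F_eq: "F ((p, m), k) \<omega> = g (pdp D t \<omega>) * of_bool (jump_count D t \<omega> = n \<and>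
      (\<forall>i\<le>n. \<tau> D i \<omega> = enat ((p(0 := 0)) i)) \<and> Nstar D t \<omega> = m \<and> \<theta> D n \<omega> = k)"
    if \<omega>: "\<omega> \<in> space (Pr D)" and pm: "(p, m) \<in> S" for p m k \<omega>
    unfolding F_def prod.case by (rule jump_term_eq[OF \<omega> t S[OF pm] n])
  \<comment> \<open>With \<open>n\<close> jumps, the distinguished triple consists of the actual
    jump indices, the actual number of Poisson points and the actual last mode; otherwise every term
    vanishes.\<close>
  have single: "\<exists>j0. j0 \<in> S \<times> UNIV \<and> (\<forall>j\<in>S \<times> UNIV. F j \<omega> =
      (if j = j0 then g (pdp D t \<omega>) * of_bool (jump_count D t \<omega> = n) else 0))
      \<or> jump_count D t \<omega> \<noteq> n \<and> (\<forall>j\<in>S \<times> UNIV. F j \<omega> = 0)" if \<omega>: "\<omega> \<in> space (Pr D)" for \<omega>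
  proof (cases "jump_count D t \<omega> = n")
    case True
    define p0 where "p0 = (\<lambda>i\<in>{1..n}. the_enat (\<tau> D i \<omega>))"
    note p0 = jump_indices[OF \<omega> t True, folded p0_def]
    define j0 where "j0 = ((p0, Nstar D t \<omega>), \<theta> D n \<omega>)"
    have "j0 \<in> S \<times> UNIV"
      using p0(2,3) by (simp add: j0_def S_def)
    moreover have "F j \<omega> = (if j = j0 then g (pdp D t \<omega>) * of_bool (jump_count D t \<omega> = n) else 0)"
      if "j \<in> S \<times> UNIV" for j
    proof -
      obtain p m k where j: "j = ((p, m), k)"
        by (metis surj_pair)
      then have pm: "(p, m) \<in> S"
        using that by simp
      have "(\<forall>i\<le>n. \<tau> D i \<omega> = enat ((p(0 := 0)) i)) \<longleftrightarrow> (\<forall>i\<in>{1..n}. p0 i = p i)"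
      proof
        assume L: "\<forall>i\<le>n. \<tau> D i \<omega> = enat ((p(0 := 0)) i)"
        show "\<forall>i\<in>{1..n}. p0 i = p i"
        proof
          fix i assume i: "i \<in> {1..n}"
          then have "\<tau> D i \<omega> = enat (p i)"
            using L by (auto simp del: \<tau>.simps)
          with p0(1)[OF i] show "p0 i = p i"
            by simp
        qed
      next
        assume R: "\<forall>i\<in>{1..n}. p0 i = p i"
        show "\<forall>i\<le>n. \<tau> D i \<omega> = enat ((p(0 := 0)) i)"
        proof (intro allI impI)
          fix i assume "i \<le> n"
          then show "\<tau> D i \<omega> = enat ((p(0 := 0)) i)"
            using R p0(1)[of i] by (cases "i = 0") (simp_all add: zero_enat_def)
        qed
      qed
      \<comment> \<open>Both functions are extensional, so agreement on \<open>{1..n}\<close> is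
        equality.\<close>
      also have "\<dots> \<longleftrightarrow> p = p0"
        using pm p0(2) by (auto simp: S_def PiE_def intro: extensionalityI[of p "{1..n}" p0])
      finally have tau_iff: "(\<forall>i\<le>n. \<tau> D i \<omega> = enat ((p(0 := 0)) i)) \<longleftrightarrow> p = p0" .
      have "p = p0 \<and> Nstar D t \<omega> = m \<and> \<theta> D n \<omega> = k \<longleftrightarrow> j = j0"
        by (auto simp: j j0_def)
      moreover have "F j \<omega> = g (pdp D t \<omega>) *
          of_bool (jump_count D t \<omega> = n \<and> p = p0 \<and> Nstar D t \<omega> = m \<and> \<theta> D n \<omega> = k)"
        using F_eq[OF \<omega> pm, of k] unfolding j tau_iff .
      ultimately show ?thesis
        by (simp add: True)
    qed
    ultimately show ?thesis by blast
  next
    case False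
    have "F j \<omega> = 0" if "j \<in> S \<times> UNIV" for j
    proof -
      obtain p m k where j: "j = ((p, m), k)"
        by (metis surj_pair)
      then have pm: "(p, m) \<in> S"
        using that by simp
      show ?thesis
        using F_eq[OF \<omega> pm, of k] False by (simp add: j)
    qed
    with False show ?thesis by blast
  qed
  fix \<omega> assume \<omega>: "\<omega> \<in> space (Pr D)"
  let ?f = "g (pdp D t \<omega>) * of_bool (jump_count D t \<omega> = n)"
  have f_le: "\<bar>?f\<bar> \<le> C"
    by (rule abs_mult_unit_le) (simp_all add: g_le)
  show "((\<lambda>j. F j \<omega>) has_sum ?f) (S \<times> UNIV)"
    using single[OF \<omega>]
  proof (elim exE disjE conjE)
    fix j0 assume j0: "j0 \<in> S \<times> UNIV" and *: "\<forall>j\<in>S \<times> UNIV. F j \<omega> = (if j = j0 then ?f else 0)"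
    show ?thesis
    proof (rule has_sum_finite_neutralI)
      show "F j \<omega> = 0" if "j \<in> S \<times> UNIV - {j0}" for j
        using bspec[OF *, of j] that by simp
      show "?f = (\<Sum>j\<in>{j0}. F j \<omega>)"
        using bspec[OF * j0] by simp
    qed (use j0 in simp_all)
  next
    assume "jump_count D t \<omega> \<noteq> n" "\<forall>j\<in>S \<times> UNIV. F j \<omega> = 0"
    then show ?thesis
      by (intro has_sum_finite_neutralI[of "{}"]) auto
  qed
  show "(\<Sum>j\<in>A. \<bar>F j \<omega>\<bar>) \<le> C" if A: "finite A" "A \<subseteq> S \<times> UNIV" for A
    using single[OF \<omega>]
  proof (elim exE disjE conjE)
    fix j0 assume "\<forall>j\<in>S \<times> UNIV. F j \<omega> = (if j = j0 then ?f else 0)"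
    then have "(\<Sum>j\<in>A. \<bar>F j \<omega>\<bar>) = (\<Sum>j\<in>A. if j = j0 then \<bar>?f\<bar> else 0)"
      using A(2) by (intro sum.cong) auto
    also have "\<dots> \<le> \<bar>?f\<bar>"
      using A(1) by (simp add: sum.delta)
    finally show ?thesis
      using f_le by simp
  next
    assume "\<forall>j\<in>S \<times> UNIV. F j \<omega> = 0"
    then have "(\<Sum>j\<in>A. \<bar>F j \<omega>\<bar>) = (\<Sum>j\<in>A. 0)"
      using A(2) by (intro sum.cong) auto
    with f_le show ?thesis by simp
  qed
qed

end

text \<open>Extensional tuples let each choice of indices be counted once. The summability conjunct
  ensures that the inner infinite sum is a genuine sum rather than the default value 0.\<close>

theorem proposition2p1:
  fixes D :: "('k, 'w) thinning_data"
    and g :: "'k \<times> real \<Rightarrow> real"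
    and n :: nat
    and t horizon :: real
  assumes "pdp_thinning D"
    and "n \<ge> 1"
    and "t \<in> {0..horizon}"
    and "g \<in> borel_measurable state_space"
    and "bounded (range g)"
  shows
    "let S = {(p :: nat \<Rightarrow> nat, m :: nat). p \<in> {1..n} \<rightarrow>\<^sub>E {1..m} \<and> strict_mono_on {1..n} p};
         I = (\<lambda>p m \<theta>'. \<integral>\<omega>.
                Q_mode D (pdp_minus D (Tstar D (p n) \<omega>) \<omega>) \<theta>'
                * g (\<theta>', \<Phi> D \<theta>' (t - Tstar D (p n) \<omega>) (\<nu> D n \<omega>))
                * of_bool ((\<forall>i\<in>{1..n}. \<tau> D i \<omega> = enat (p i)) \<and> Nstar D t \<omega> = m)
                * (\<Prod>q = p n + 1..m.
                     1 - rate D (\<theta>', \<Phi> D \<theta>' (Tstar D q \<omega> - Tstar D (p n) \<omega>) (\<nu> D n \<omega>)) / rate_bound D)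
              \<partial>Pr D)
     in (\<forall>\<omega>\<in>space (Pr D). \<forall>p. (\<forall>i\<in>{1..n}. \<tau> D i \<omega> = enat (p i)) \<longrightarrow>
           pdp_minus D (Tstar D (p n) \<omega>) \<omega> = (\<theta> D (n - 1) \<omega>, \<nu> D n \<omega>)) \<and>
        (\<forall>(p, m)\<in>S. (\<lambda>\<theta>'. I p m \<theta>') summable_on UNIV) \<and>
        ((\<lambda>(p, m). \<Sum>\<^sub>\<infinity>\<theta>'\<in>UNIV. I p m \<theta>') has_sum
           (\<integral>\<omega>. g (pdp D t \<omega>) * of_bool (jump_count D t \<omega> = n) \<partial>Pr D)) S"
proof -
  interpret pdp_thinning D by fact
  define S where "S = {(p :: nat \<Rightarrow> nat, m :: nat). p \<in> {1..n} \<rightarrow>\<^sub>E {1..m} \<and> strict_mono_on {1..n} p}"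
  define I where "I p m \<theta>' = (\<integral>\<omega>.
                Q_mode D (pdp_minus D (Tstar D (p n) \<omega>) \<omega>) \<theta>'
                * g (\<theta>', \<Phi> D \<theta>' (t - Tstar D (p n) \<omega>) (\<nu> D n \<omega>))
                * of_bool ((\<forall>i\<in>{1..n}. \<tau> D i \<omega> = enat (p i)) \<and> Nstar D t \<omega> = m)
                * (\<Prod>q = p n + 1..m.
                     1 - rate D (\<theta>', \<Phi> D \<theta>' (Tstar D q \<omega> - Tstar D (p n) \<omega>) (\<nu> D n \<omega>)) / rate_bound D)
              \<partial>Pr D)" for p m \<theta>'
  define R where "R = (\<integral>\<omega>. g (pdp D t \<omega>) * of_bool (jump_count D t \<omega> = n) \<partial>Pr D)"
  have t: "0 \<le> t"
    using assms(3) by simp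
  obtain C where C: "\<And>x. \<bar>g x\<bar> \<le> C"
    using assms(5) by (auto simp: bounded_iff)
  obtain l where l: "n = Suc l"
    using assms(2) by (cases n) auto
  have I_eq: "(\<integral>\<omega>. jump_term g t (p(0 := 0)) n m k (\<lambda>j. Tstar D j \<omega>) (\<lambda>j. Useq D j \<omega>) (\<lambda>j. Vseq D j \<omega>) \<partial>Pr D) = I p m k"
    if "(p, m) \<in> S" for p m k
  proof -
    have p: "strict_mono_upto n (p(0 := 0))"
      using that by (intro strict_mono_upto_extend[of _ _ m]) (auto simp: S_def)
    have "p \<in> {1..n} \<rightarrow>\<^sub>E {1..m}"
      using that by (simp add: S_def)
    then have "p n \<in> {1..m}"
      by (rule PiE_mem) (use assms(2) in simp)
    then have pn: "(p(0 := 0)) n \<le> m"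
      using assms(2) by simp
    have upd: "(p(0 := 0)) i = p i" if "i \<in> {1..n}" for i
      using that by simp
    have "n \<in> {1..n}"
      using assms(2) by simp
    then have updn: "(p(0 := 0)) n = p n"
      by (rule upd)
    have ball: "(\<forall>i\<in>{1..n}. \<tau> D i \<omega> = enat ((p(0 := 0)) i)) \<longleftrightarrow> (\<forall>i\<in>{1..n}. \<tau> D i \<omega> = enat (p i))" for \<omega>
      by (intro ball_cong refl) (simp only: upd)
    have "(\<integral>\<omega>. averaged_term g t (p(0 := 0)) n l m k (\<lambda>j. Tstar D j \<omega>) (\<lambda>j. Useq D j \<omega>) (\<lambda>j. Vseq D j \<omega>) \<partial>Pr D) = I p m k"
      unfolding I_def
      by (intro Bochner_Integration.integral_cong refl)
        (simp only: averaged_term_eq[OF _ t p pn l] updn ball)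
    then show ?thesis
      by (simp only: integral_jump_term[OF assms(4) C p pn l])
  qed
  \<comment> \<open>Unordered summation over all triples at once justifies the iterated form:
    restricting to a fixed pair gives inner summability, and summing the inner sums recovers the
    same total.\<close>
  have sum: "((\<lambda>((p, m), k). I p m k) has_sum R) (S \<times> UNIV)"
    using has_sum_jump_term[OF assms(4) C t assms(2), folded S_def R_def]
    by (rule has_sum_cong[THEN iffD1, rotated]) (auto simp: I_eq)
  have summable: "(\<lambda>k. I p m k) summable_on UNIV" if "(p, m) \<in> S" for p m
  proof -
    from summable_on_SigmaD1[OF has_sum_imp_summable[OF sum] that] show ?thesis by simp
  qed
  have "((\<lambda>(p, m). \<Sum>\<^sub>\<infinity>k\<in>UNIV. I p m k) has_sum R) S"
    using sum by (rule has_sum_SigmaD) (auto intro!: has_sum_infsum summable)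
  moreover have "pdp_minus D (Tstar D (p n) \<omega>) \<omega> = (\<theta> D (n - 1) \<omega>, \<nu> D n \<omega>)"
    if "\<omega> \<in> space (Pr D)" "\<forall>i\<in>{1..n}. \<tau> D i \<omega> = enat (p i)" for \<omega> and p :: "nat \<Rightarrow> nat"
    using that assms(2) by (intro pdp_minus_eq) auto
  ultimately show ?thesis
    unfolding Let_def S_def[symmetric] I_def[symmetric] R_def[symmetric]
    using summable by blast
qed

end
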